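(* The Frattini subgroup $\Phi$ of $M_\infty$ (the intersection of all maximal proper subgroups of $M_\infty$) has index $16$ in $M_\infty$, and it consists precisely of those $\sigma\in M_\infty$ such that: $\sigma$ fixes both nodes $a$ and $b$ at level $1$ of $T_\infty$; $\sigma$ acts as an even permutation on the four nodes $aa,ab,ba,bb$ at level $2$; and $P(\sigma,x_0)\equiv1\pmod 8$.
   Context: $T_\infty$ is the infinite binary rooted tree whose nodes at level $m\ge0$ are words of length $m$ over $\{a,b\}$ (root $x_0$ = empty word), each $w$ joined to $wa,wb$; $\mathrm{Aut}(T_\infty)$ is its root-preserving automorphism group. $\mathrm{Par}(\sigma,x)=0$ if $\sigma(xa)=\sigma(x)a$ and $\sigma(xb)=\sigma(x)b$, and $=1$ if $\sigma(xa)=\sigma(x)b$ and $\sigma(xb)=\sigma(x)a$. $Q(\sigma,x):=\sum_{i\ge0}2^i\sum_{s_1,\ldots,s_i\in\{a,b\}}\mathrm{Par}(\sigma,x\,a\,s_1\,a\,s_2\cdots a\,s_i)\in\mathbb{Z}_2$ (concatenated words), $P(\sigma,x):=(-1)^{\mathrm{Par}(\sigma,x)}+2\sum_{t\in\{a,b\}}Q(\sigma,xbt)-2\sum_{t\in\{a,b\}}Q(\sigma,xat)\in\mathbb{Z}_2^\times$. $M_\infty:=\{\sigma\in\mathrm{Aut}(T_\infty):P(\sigma,x)=P(\sigma,x_0)\text{ for all nodes }x\}$, a closed subgroup of $\mathrm{Aut}(T_\infty)$ (profinite topology). *)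

theory Defs
  imports
    "HOL-Analysis.Analysis"
    "HOL-Algebra.Coset"
    "HOL-Combinatorics.Permutations"
begin

section \<open>The 2-adic integers\<close>

text \<open>The inverse limit of the rings of residues modulo \<open>2 ^ n\<close>; the \<open>n\<close>-th entry is the
  representative in \<open>{0..<2 ^ n}\<close> of the residue class modulo \<open>2 ^ n\<close>.\<close>

typedef zadic2 = "{f :: nat \<Rightarrow> int. \<forall>n. f n = f (Suc n) mod 2 ^ n}"
  morphisms residue Abs_zadic2
  by (rule exI[of _ "\<lambda>_. 0"]) simp

setup_lifting type_definition_zadic2

lemma residue_Suc_mod: "residue x (Suc n) mod 2 ^ n = residue x n"
  by (rule sym) (rule CollectD[OF residue, THEN spec])

lemma residue_mod [simp]: "residue x n mod 2 ^ n = residue x n"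
  using residue_Suc_mod[of x n] by (metis mod_mod_trivial)

lemma zadic2_eqI: "(\<And>n. residue x n = residue y n) \<Longrightarrow> x = y"
  by (simp add: residue_inject[symmetric] fun_eq_iff)

lemma mod_pow_Suc_mod: "(a mod 2 ^ Suc n) mod 2 ^ n = a mod (2 ^ n :: int)"
  by (intro mod_mod_cancel) simp

instantiation zadic2 :: comm_ring_1
begin

lift_definition zero_zadic2 :: zadic2 is "\<lambda>n. 0"
  by simp

lift_definition one_zadic2 :: zadic2 is "\<lambda>n. 1 mod 2 ^ n"
  by (simp only: mod_pow_Suc_mod)

lift_definition plus_zadic2 :: "zadic2 \<Rightarrow> zadic2 \<Rightarrow> zadic2" is
  "\<lambda>f g n. (f n + g n) mod 2 ^ n"
  subgoal premises p for f g n
    using mod_add_eq[of "f (Suc n)" "2 ^ n" "g (Suc n)"]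
    by (simp only: mod_pow_Suc_mod p[symmetric])
  done

lift_definition uminus_zadic2 :: "zadic2 \<Rightarrow> zadic2" is
  "\<lambda>f n. (- f n) mod 2 ^ n"
  subgoal premises p for f n
    using mod_minus_eq[of "f (Suc n)" "2 ^ n"]
    by (simp only: mod_pow_Suc_mod p[symmetric])
  done

lift_definition minus_zadic2 :: "zadic2 \<Rightarrow> zadic2 \<Rightarrow> zadic2" is
  "\<lambda>f g n. (f n - g n) mod 2 ^ n"
  subgoal premises p for f g n
    using mod_diff_eq[of "f (Suc n)" "2 ^ n" "g (Suc n)"]
    by (simp only: mod_pow_Suc_mod p[symmetric])
  done

lift_definition times_zadic2 :: "zadic2 \<Rightarrow> zadic2 \<Rightarrow> zadic2" is
  "\<lambda>f g n. (f n * g n) mod 2 ^ n"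
  subgoal premises p for f g n
    using mod_mult_eq[of "f (Suc n)" "2 ^ n" "g (Suc n)"]
    by (simp only: mod_pow_Suc_mod p[symmetric])
  done

instance
proof
  note reps = zero_zadic2.rep_eq one_zadic2.rep_eq plus_zadic2.rep_eq uminus_zadic2.rep_eq
    minus_zadic2.rep_eq times_zadic2.rep_eq
  fix a b c :: zadic2
  show "a * b * c = a * (b * c)"
    by (rule zadic2_eqI) (simp add: reps mod_simps mult.assoc)
  show "a * b = b * a"
    by (rule zadic2_eqI) (simp add: reps mult.commute)
  show "1 * a = a"
  proof (rule zadic2_eqI)
    fix n show "residue (1 * a) n = residue a n"
      using mod_mult_left_eq[of 1 "2 ^ n" "residue a n"] by (simp only: reps mult_1 residue_mod)
  qed
  show "a + b + c = a + (b + c)"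
    by (rule zadic2_eqI) (simp add: reps mod_simps add.assoc)
  show "a + b = b + a"
    by (rule zadic2_eqI) (simp add: reps add.commute)
  show "0 + a = a"
    by (rule zadic2_eqI) (simp add: reps)
  show "- a + a = 0"
    by (rule zadic2_eqI) (simp add: reps mod_simps)
  show "a - b = a + - b"
    by (rule zadic2_eqI) (simp add: reps mod_simps)
  show "(a + b) * c = a * c + b * c"
    by (rule zadic2_eqI) (simp add: reps mod_simps distrib_right)
  show "(0 :: zadic2) \<noteq> 1"
  proof
    assume "(0 :: zadic2) = 1"
    then have "residue 0 1 = residue 1 1" by simp
    then show False by (simp add: zero_zadic2.rep_eq one_zadic2.rep_eq)
  qed
qed

end

text \<open>The 2-adic metric \<open>2 powr (- v (x - y))\<close>, where the valuation \<open>v (x - y)\<close> is the largest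
  \<open>n\<close> such that \<open>x\<close> and \<open>y\<close> agree modulo \<open>2 ^ n\<close>.\<close>

instantiation zadic2 :: metric_space
begin

definition dist_zadic2 :: "zadic2 \<Rightarrow> zadic2 \<Rightarrow> real" where
  "dist_zadic2 x y =
     (if x = y then 0 else (1/2) ^ (LEAST n. residue x (Suc n) \<noteq> residue y (Suc n)))"

definition uniformity_zadic2 :: "(zadic2 \<times> zadic2) filter" where
  "uniformity_zadic2 = (INF e\<in>{0 <..}. principal {(x, y). dist x y < e})"

definition open_zadic2 :: "zadic2 set \<Rightarrow> bool" where
  "open_zadic2 S = (\<forall>x\<in>S. \<forall>\<^sub>F (x', y) in uniformity. x' = x \<longrightarrow> y \<in> S)"

lemma residue_eq_mono:
  assumes "residue x n = residue y n" "m \<le> n"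
  shows "residue x m = residue y m"
  using assms(2)
proof (induction rule: inc_induct)
  case base
  show ?case by (rule assms)
next
  case (step k)
  then show ?case
    using residue_Suc_mod[of x k] residue_Suc_mod[of y k] by simp
qed

lemma dist_zadic2_le_iff: "dist x y \<le> (1/2) ^ n \<longleftrightarrow> residue x n = residue y n" for x y :: zadic2
proof (cases "x = y")
  case False
  define N where "N = (LEAST n. residue x (Suc n) \<noteq> residue y (Suc n))"
  have "\<exists>n. residue x (Suc n) \<noteq> residue y (Suc n)"
  proof (rule ccontr)
    assume "\<not> ?thesis"
    then have "residue x n = residue y n" for n
      using residue_Suc_mod[of x n] residue_Suc_mod[of y n] by simp
    then show False
      using False zadic2_eqI by blast
  qed
  then have N: "residue x (Suc N) \<noteq> residue y (Suc N)"
    unfolding N_def by (rule LeastI_ex)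
  have "residue x k = residue y k" if "k \<le> N" for k
  proof (cases k)
    case 0
    then show ?thesis using residue_mod[of x 0] residue_mod[of y 0] by simp
  next
    case (Suc m)
    then show ?thesis using that not_less_Least[of m "\<lambda>n. residue x (Suc n) \<noteq> residue y (Suc n)"]
      unfolding N_def by auto
  qed
  moreover have "residue x k \<noteq> residue y k" if "k > N" for k
    using N residue_eq_mono[of x k y "Suc N"] that by auto
  ultimately have "residue x n = residue y n \<longleftrightarrow> n \<le> N"
    by (meson not_le)
  moreover have "(1/2 :: real) ^ N \<le> (1/2) ^ n \<longleftrightarrow> n \<le> N"
    by (simp add: power_decreasing_iff)
  ultimately show ?thesis
    using False by (simp add: dist_zadic2_def N_def)
qed (simp add: dist_zadic2_def)

instance
proof
  fix x y z :: zadic2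
  show "uniformity = (INF e\<in>{0 <..}. principal {(x :: zadic2, y). dist x y < e})"
    by (rule uniformity_zadic2_def)
  show "open U = (\<forall>x\<in>U. \<forall>\<^sub>F (x', y) in uniformity. x' = x \<longrightarrow> y \<in> U)" for U :: "zadic2 set"
    by (rule open_zadic2_def)
  show "dist x y = 0 \<longleftrightarrow> x = y"
    by (simp add: dist_zadic2_def)
  have nonneg: "dist u v \<ge> 0" for u v :: zadic2
    by (simp add: dist_zadic2_def)
  have form: "u = v \<or> (\<exists>n. dist u v = (1/2) ^ n)" for u v :: zadic2
    by (auto simp: dist_zadic2_def)
  have ultra: "dist x y \<le> dist x z" if "dist y z \<le> dist x z" for x y z :: zadic2
  proof (cases "x = z")
    case True
    then have "y = z" using that nonneg[of y z] form[of y z] by (auto simp: dist_zadic2_def)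
    then show ?thesis using True by simp
  next
    case False
    then obtain n where n: "dist x z = (1/2) ^ n" using form by blast
    then show ?thesis
      using that dist_zadic2_le_iff[of x z n] dist_zadic2_le_iff[of y z n]
        dist_zadic2_le_iff[of x y n] by simp
  qed
  have sym: "dist x y = dist y x" for x y :: zadic2
    by (simp add: dist_zadic2_def eq_commute)
  show "dist x y \<le> dist x z + dist y z"
    using ultra[of y z x] ultra[of x z y] sym[of x y] nonneg[of x z] nonneg[of y z] by linarith
qed

end

text \<open>Convergence of all the series occurring below.\<close>

lemma residue_power_two_times:
  assumes "n \<le> i"
  shows "residue (2 ^ i * x) n = 0"
proof -
  have num: "residue (of_nat k) n = int k mod 2 ^ n" for k
    by (induction k) (simp_all add: zero_zadic2.rep_eq one_zadic2.rep_eq plus_zadic2.rep_eq mod_simps)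
  have "residue (2 ^ i :: zadic2) n = 2 ^ i mod 2 ^ n"
    using num[of "2 ^ i"] by simp
  also have "\<dots> = 0"
    using assms by (simp add: le_imp_power_dvd)
  finally show ?thesis
    by (simp add: times_zadic2.rep_eq)
qed

lemma summable_power_two_times: "summable (\<lambda>i. 2 ^ i * c i :: zadic2)"
proof -
  define s where "s n = (\<Sum>i<n. 2 ^ i * c i)" for n
  have step: "residue (s (n + k)) n = residue (s n) n" for n k
  proof (induction k)
    case (Suc k)
    have "s (n + Suc k) = s (n + k) + 2 ^ (n + k) * c (n + k)"
      by (simp add: s_def)
    then show ?case
      using Suc by (simp add: plus_zadic2.rep_eq residue_power_two_times)
  qed simp
  define L where "L = Abs_zadic2 (\<lambda>n. residue (s n) n)"
  have "residue (s n) n = residue (s (Suc n)) (Suc n) mod 2 ^ n" for n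
    using step[of n 1] by (simp add: residue_Suc_mod)
  then have "(\<lambda>n. residue (s n) n) \<in> {f. \<forall>n. f n = f (Suc n) mod 2 ^ n}"
    by (intro CollectI allI)
  then have L: "residue L n = residue (s n) n" for n
    by (simp only: L_def Abs_zadic2_inverse)
  have "s \<longlonglongrightarrow> L"
  proof (rule metric_LIMSEQ_I)
    fix r :: real assume "r > 0"
    then obtain n where n: "(1/2) ^ n < r"
      using real_arch_pow_inv[of r "1/2"] by auto
    have "dist (s m) L < r" if "m \<ge> n" for m
    proof -
      have "residue (s m) n = residue L n"
        using step[of n "m - n"] that L[of n] by simp
      then show ?thesis
        using n dist_zadic2_le_iff[of "s m" L n] by linarith
    qed
    then show "\<exists>no. \<forall>m\<ge>no. dist (s m) L < r" by blast
  qed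
  then show ?thesis
    unfolding summable_def sums_def s_def by blast
qed


section \<open>The binary rooted tree and its automorphisms\<close>

datatype letter = a | b

lemma UNIV_letter: "UNIV = {a, b}"
  using letter.exhaust by auto

instance letter :: finite
  by standard (simp add: UNIV_letter)

text \<open>Nodes are words, the root is \<open>[]\<close>, and the children of \<open>w\<close> are \<open>w @ [a]\<close> and \<open>w @ [b]\<close>.\<close>

type_synonym node = "letter list"

definition tree_adj :: "node \<Rightarrow> node \<Rightarrow> bool" where
  "tree_adj v w \<longleftrightarrow> (\<exists>s. w = v @ [s] \<or> v = w @ [s])"

definition tree_aut :: "(node \<Rightarrow> node) set" where
  "tree_aut = {\<sigma>. bij \<sigma> \<and> \<sigma> [] = [] \<and> (\<forall>v w. tree_adj (\<sigma> v) (\<sigma> w) \<longleftrightarrow> tree_adj v w)}"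

text \<open>The profinite topology, i.e. the inverse limit topology of the automorphism groups of the
  finite subtrees, is the topology of pointwise convergence on the discrete set of nodes.\<close>

definition aut_topology :: "(node \<Rightarrow> node) topology" where
  "aut_topology = subtopology (product_topology (\<lambda>_. discrete_topology UNIV) UNIV) tree_aut"

text \<open>For a tree automorphism, the negation of the condition below says that \<open>\<sigma>\<close> maps
  \<open>x @ [a]\<close> to \<open>\<sigma> x @ [b]\<close> and \<open>x @ [b]\<close> to \<open>\<sigma> x @ [a]\<close>.\<close>

definition Par :: "(node \<Rightarrow> node) \<Rightarrow> node \<Rightarrow> nat" where
  "Par \<sigma> x = (if \<sigma> (x @ [a]) = \<sigma> x @ [a] \<and> \<sigma> (x @ [b]) = \<sigma> x @ [b] then 0 else 1)"

text \<open>The inner sum ranges over the words \<open>s = [s\<^sub>1, \<dots>, s\<^sub>i]\<close>, and the node occurring in it is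
  \<open>x a s\<^sub>1 a s\<^sub>2 \<dots> a s\<^sub>i\<close>.\<close>

definition Q :: "(node \<Rightarrow> node) \<Rightarrow> node \<Rightarrow> zadic2" where
  "Q \<sigma> x = (\<Sum>i. 2 ^ i *
     (\<Sum>s | length s = i. of_nat (Par \<sigma> (x @ concat (map (\<lambda>t. [a, t]) s)))))"

definition P :: "(node \<Rightarrow> node) \<Rightarrow> node \<Rightarrow> zadic2" where
  "P \<sigma> x = (- 1) ^ Par \<sigma> x
     + 2 * (\<Sum>t\<in>{a, b}. Q \<sigma> (x @ [b, t])) - 2 * (\<Sum>t\<in>{a, b}. Q \<sigma> (x @ [a, t]))"

definition M_inf :: "(node \<Rightarrow> node) monoid" where
  "M_inf = \<lparr>carrier = {\<sigma> \<in> tree_aut. \<forall>x. P \<sigma> x = P \<sigma> []}, mult = (\<circ>), one = id\<rparr>"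


section \<open>The Frattini subgroup of a topological group\<close>

text \<open>As usual for profinite groups, subgroups are understood to be closed: the Frattini subgroup
  is the intersection of the maximal proper closed (equivalently, maximal open) subgroups, and
  the whole group if there are none. Abstract maximal subgroups that are not closed do not enter.\<close>

definition closed_subgroup :: "'g set \<Rightarrow> 'g topology \<Rightarrow> ('g, 'm) monoid_scheme \<Rightarrow> bool" where
  "closed_subgroup H T G \<longleftrightarrow> subgroup H G \<and> closedin (subtopology T (carrier G)) H"

definition maximal_closed_subgroup :: "'g set \<Rightarrow> 'g topology \<Rightarrow> ('g, 'm) monoid_scheme \<Rightarrow> bool" where
  "maximal_closed_subgroup H T G \<longleftrightarrow> closed_subgroup H T G \<and> H \<noteq> carrier G \<and>
     (\<forall>K. closed_subgroup K T G \<and> H \<subseteq> K \<longrightarrow> K = H \<or> K = carrier G)"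

definition frattini :: "'g topology \<Rightarrow> ('g, 'm) monoid_scheme \<Rightarrow> 'g set" where
  "frattini T G = carrier G \<inter> \<Inter>{H. maximal_closed_subgroup H T G}"

end

theory Submission
  imports Defs "HOL-Algebra.Generated_Groups"
begin

text \<open>The series \<open>Q\<close> satisfies \<open>Q \<sigma> = Par \<sigma> + 2 * R (sec \<sigma> [a])\<close> at the root, where
  \<open>R \<sigma> = Q (sec \<sigma> [a]) + Q (sec \<sigma> [b])\<close>. By induction modulo powers of two, \<open>P\<close> is a homomorphism
  on M and \<open>Q\<close> and \<open>R\<close> are 1-cocycles with values in the module on which M acts through \<open>P\<close>.
  Hence \<open>Q\<close> and \<open>R\<close> modulo 2 and \<open>P\<close> modulo 8 are characters onto a group of exponent two and
  order 16, which bounds the Frattini subgroup from above.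

  For the converse, a maximal closed subgroup H is open, and a central filtration of the level
  stabilizers shows that H contains all squares, hence has index two. An element with \<open>P \<equiv> 1\<close>
  modulo 8 is, up to the square of an element with prescribed \<open>P\<close>, a limit of words in the
  two generators of the basilica group; on such words \<open>Q\<close> and \<open>R\<close> are the exponent sums, so if
  both are even the word lies in H.\<close>

section \<open>Divisibility by powers of two in the 2-adic integers\<close>

text \<open>The shape of \<open>P\<close> is forced by the recursion for \<open>Q\<close>. If \<tau>
  swaps the children of the root, \<open>Q (\<sigma> \<circ> \<tau>) []\<close> reads the section of
  \<sigma> at \<open>b\<close> where \<open>Q \<sigma> []\<close> reads the one at \<open>a\<close>,
  and the resulting discrepancy, including the flip of the parity, is exactly
  \<open>P \<sigma> []\<close>. Constancy of \<open>P\<close> over all nodes makes this correction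
  the same scalar at every depth. The recursions never bottom out, so identities are proved modulo
  each power of two, and one factor 2 always costs two levels of the tree; all level bounds below
  follow this rate.

  The modulus 8 comes from the units: a 2-adic unit is a square if and only if it is 1 modulo 8. So
  \<open>P\<close> contributes the unit group modulo 8, of order 4, and the parities of
  \<open>Q\<close> and \<open>R\<close> contribute a factor 2 each, which gives 16. The words in the
  two generators are only dense in the kernel of \<open>P\<close>; this is enough because a maximal
  closed subgroup already contains a level stabilizer.\<close>

lemma residue_range: "residue x n \<ge> 0" "residue x n < 2 ^ n"
proof -
  have "residue x n = residue x n mod 2 ^ n" by simp
  then show "residue x n \<ge> 0" "residue x n < 2 ^ n"
    by (metis pos_mod_sign pos_mod_bound zero_less_power zero_less_numeral)+
qed

lemma residue_of_nat: "residue (of_nat k) n = int k mod 2 ^ n"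
  by (induction k) (simp_all add: zero_zadic2.rep_eq one_zadic2.rep_eq plus_zadic2.rep_eq mod_simps)

lemma residue_drop: "residue x (m + n) mod 2 ^ m = residue x m"
proof (induction n)
  case (Suc n)
  have "residue x (m + Suc n) mod 2 ^ m = (residue x (Suc (m + n)) mod 2 ^ (m + n)) mod 2 ^ m"
    by (simp add: mod_mod_cancel le_imp_power_dvd)
  then show ?case using Suc by (simp add: residue_Suc_mod)
qed simp

lemma power2_dvd_iff: "2 ^ n dvd x \<longleftrightarrow> residue x n = 0"
proof
  assume "2 ^ n dvd x"
  then show "residue x n = 0"
    by (auto simp: residue_power_two_times elim!: dvdE)
next
  assume x: "residue x n = 0"
  \<comment> \<open>The residues of the quotient: precision \<open>n + m\<close> of \<open>x\<close>
    yields precision \<open>m\<close> after division by \<open>2 ^ n\<close>.\<close>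
  define f where "f m = residue x (n + m) div 2 ^ n" for m
  have dv: "residue x (n + m) = 2 ^ n * f m" for m
  proof -
    have "residue x (n + m) mod 2 ^ n = 0" using x residue_drop[of x n m] by simp
    then show ?thesis unfolding f_def by (metis mult_div_mod_eq add.right_neutral)
  qed
  have "f m = f (Suc m) mod 2 ^ m" for m
  proof -
    have "residue x (n + m) = residue x (n + Suc m) mod 2 ^ (n + m)"
      by (simp add: residue_Suc_mod)
    then have "2 ^ n * f m = 2 ^ n * (f (Suc m) mod 2 ^ m)"
      by (simp only: dv power_add mult_mod_right)
    then show ?thesis by simp
  qed
  then have f: "residue (Abs_zadic2 f) = f"
    by (intro Abs_zadic2_inverse) blast
  have "x = 2 ^ n * Abs_zadic2 f"
  proof (rule zadic2_eqI)
    fix m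
    have "residue (2 ^ n * Abs_zadic2 f) m = (residue (of_nat (2 ^ n)) m * f m) mod 2 ^ m"
      by (simp add: times_zadic2.rep_eq f)
    also have "\<dots> = (2 ^ n * f m) mod 2 ^ m"
      unfolding residue_of_nat by (simp add: mod_simps)
    also have "\<dots> = residue x m"
      using residue_drop[of x m n] by (simp add: dv[symmetric] add.commute)
    finally show "residue x m = residue (2 ^ n * Abs_zadic2 f) m" ..
  qed
  then show "2 ^ n dvd x" by simp
qed

lemma zadic2_eq_0I:
  assumes "\<And>n. 2 ^ n dvd (x :: zadic2)"
  shows "x = 0"
  using assms by (intro zadic2_eqI) (simp add: power2_dvd_iff zero_zadic2.rep_eq)

lemma zadic2_eq_by_dvd:
  assumes "\<And>n. 2 ^ n dvd (x - y :: zadic2)"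
  shows "x = y"
  using zadic2_eq_0I[of "x - y"] assms by simp

lemma power2_dvd_eq_residue: "2 ^ n dvd (x - y) \<longleftrightarrow> residue x n = residue y n"
  using mod_eq_dvd_iff[of "residue x n" "2 ^ n" "residue y n"]
  by (simp only: power2_dvd_iff minus_zadic2.rep_eq residue_mod dvd_eq_mod_eq_0)

text \<open>Doubling shifts binary digits by one place, so a factor 2 is worth exactly one unit of
  precision. This drives the inductions modulo powers of two and serves as cancellation of
  2.\<close>

lemma zadic2_cancel_2:
  fixes z :: zadic2
  shows "2 ^ Suc n dvd 2 * z \<longleftrightarrow> 2 ^ n dvd z"
proof
  assume "2 ^ Suc n dvd 2 * z"
  then have "residue (2 * z) (Suc n) = 0" by (simp only: power2_dvd_iff)
  then have "(residue z (Suc n) + residue z (Suc n)) mod 2 ^ Suc n = 0"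
    by (simp only: mult_2 plus_zadic2.rep_eq)
  then have "(2 :: int) * 2 ^ n dvd 2 * residue z (Suc n)"
    by (metis mult_2 mod_0_imp_dvd power_Suc)
  then have "2 ^ n dvd residue z (Suc n)" by simp
  then have "residue z n = 0"
    by (metis residue_Suc_mod dvd_imp_mod_0)
  then show "2 ^ n dvd z" by (simp only: power2_dvd_iff)
qed (simp add: mult_dvd_mono)

lemma zadic2_approx: "\<exists>k. 2 ^ n dvd (x - of_nat k :: zadic2)"
proof
  show "2 ^ n dvd (x - of_nat (nat (residue x n)))"
    using residue_range[of x n] residue_mod[of x n]
    by (simp only: power2_dvd_eq_residue residue_of_nat int_nat_eq if_True)
qed

lemma residue_of_int: "residue (of_int k) n = k mod 2 ^ n"
proof (cases k rule: int_cases2)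
  case (nonneg m)
  then show ?thesis by (simp add: residue_of_nat)
next
  case (nonpos m)
  then show ?thesis by (simp add: residue_of_nat uminus_zadic2.rep_eq mod_simps)
qed

lemma power2_dvd_of_int: "2 ^ n dvd (of_int k :: zadic2) \<longleftrightarrow> 2 ^ n dvd k"
  by (simp add: power2_dvd_iff residue_of_int dvd_eq_mod_eq_0)

lemma two_dvd_of_int: "2 dvd (of_int k :: zadic2) \<longleftrightarrow> even k"
  using power2_dvd_of_int[of 1 k] by simp

lemma zadic2_parity: "2 dvd (x :: zadic2) \<or> 2 dvd x - 1"
proof -
  obtain k where k: "2 ^ 1 dvd (x - of_nat k :: zadic2)" using zadic2_approx by blast
  then obtain y where y: "x = of_int (int k) + 2 * y" by (auto elim!: dvdE simp: algebra_simps)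
  have "2 dvd (of_int (int k) :: zadic2) \<or> 2 dvd (of_int (int k - 1) :: zadic2)"
    unfolding two_dvd_of_int by auto
  moreover have "x = of_int (int k) + 2 * y" "x - 1 = of_int (int k - 1) + 2 * y"
    by (simp_all add: y)
  ultimately show ?thesis by (metis dvd_add dvd_triv_left)
qed

lemma not_two_dvd_one: "\<not> 2 dvd (1 :: zadic2)"
  using two_dvd_of_int[of 1] by simp

text \<open>Instead of inverting \<open>u = 1 + 2 * v\<close>, the identity
  \<open>z = u * z - 2 * z * v\<close> improves the divisibility of \<open>z\<close> by one power at
  a time, up to that of \<open>u * z\<close>.\<close>

lemma odd_mult_dvd_iff:
  fixes u z :: zadic2
  assumes "2 dvd u - 1"
  shows "2 ^ n dvd u * z \<longleftrightarrow> 2 ^ n dvd z"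
proof
  assume L: "2 ^ n dvd u * z"
  obtain v where u: "u = 1 + 2 * v" using assms by (auto elim!: dvdE simp: algebra_simps)
  have "2 ^ k dvd z" if "k \<le> n" for k
    using that
  proof (induction k)
    case (Suc k)
    then have "2 ^ Suc k dvd 2 * z" by (simp add: mult_dvd_mono)
    then have "2 ^ Suc k dvd 2 * z * v" by (rule dvd_mult2)
    moreover have "2 ^ Suc k dvd u * z"
      using dvd_trans[OF le_imp_power_dvd[OF Suc.prems] L] .
    moreover have "z = u * z - 2 * z * v" by (simp add: u algebra_simps)
    ultimately show ?case by (metis dvd_diff)
  qed simp
  then show "2 ^ n dvd z" by simp
qed simp

section \<open>The recursion for Q\<close>

lemma residue_suminf_power_two:
  "residue (\<Sum>i. 2 ^ i * c i) n = residue (\<Sum>i<n. 2 ^ i * c i) n"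
proof -
  define s where "s n = (\<Sum>i<n. 2 ^ i * c i)" for n
  have step: "residue (s (n + k)) n = residue (s n) n" for k
    by (induction k) (simp_all add: s_def plus_zadic2.rep_eq residue_power_two_times)
  have "s \<longlonglongrightarrow> (\<Sum>i. 2 ^ i * c i)"
    using summable_power_two_times[of c] summable_LIMSEQ unfolding s_def by blast
  then obtain N where N: "\<And>m. m \<ge> N \<Longrightarrow> dist (s m) (\<Sum>i. 2 ^ i * c i) < (1/2) ^ n"
    using metric_LIMSEQ_D[of s _ "(1/2) ^ n"] by fastforce
  have "residue (s (n + N)) n = residue (\<Sum>i. 2 ^ i * c i) n"
    using N[of "n + N"] dist_zadic2_le_iff[of "s (n + N)" "\<Sum>i. 2 ^ i * c i" n] by simp
  then show ?thesis using step by (simp add: s_def)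
qed

lemma finite_length_eq: "finite {s :: 'c :: finite list. length s = i}"
  using finite_lists_length_eq[of "UNIV :: 'c set" i] by simp

lemma sum_length_Suc:
  "(\<Sum>s | length s = Suc i. f s) = (\<Sum>s | length s = i. f (a # s)) + (\<Sum>s | length s = i. f (b # s))"
proof -
  have "{s :: letter list. length s = Suc i}
      = (Cons a ` {s. length s = i}) \<union> (Cons b ` {s. length s = i})"
  proof -
    have "s \<in> (Cons a ` {s. length s = i}) \<union> (Cons b ` {s. length s = i})"
      if s: "length s = Suc i" for s
    proof -
      obtain c t where "s = c # t" "length t = i" using s by (cases s) auto
      then show ?thesis by (cases c) auto
    qed
    then show ?thesis by auto
  qed
  moreover have "(Cons a ` {s. length s = i}) \<inter> (Cons b ` {s. length s = i}) = {}" by auto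
  ultimately show ?thesis
    by (simp add: sum.union_disjoint finite_length_eq sum.reindex)
qed

lemma Q_rec: "Q \<sigma> x = of_nat (Par \<sigma> x) + 2 * (Q \<sigma> (x @ [a, a]) + Q \<sigma> (x @ [a, b]))"
proof -
  define c :: "node \<Rightarrow> nat \<Rightarrow> zadic2" where
    "c y i = (\<Sum>s | length s = i. of_nat (Par \<sigma> (y @ concat (map (\<lambda>t. [a, t]) s))))" for y i
  have Q: "2 ^ n dvd (Q \<sigma> y - (\<Sum>i<n. 2 ^ i * c y i))" for y n
    unfolding Q_def c_def power2_dvd_eq_residue by (rule residue_suminf_power_two)
  have cS: "c y (Suc i) = c (y @ [a, a]) i + c (y @ [a, b]) i" for y i
    by (simp add: c_def sum_length_Suc)
  have c0: "c y 0 = of_nat (Par \<sigma> y)" for y by (simp add: c_def)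
  \<comment> \<open>Splitting off the first letter of \<open>s\<close> turns term
    \<open>i + 1\<close> at \<open>x\<close> into terms \<open>i\<close> at the two grandchildren
    below \<open>x @ [a]\<close>; hence \<open>Suc n\<close> terms on the left against
    \<open>n\<close> on the right.\<close>
  have ps: "(\<Sum>i<Suc n. 2 ^ i * c x i) =
      c x 0 + 2 * ((\<Sum>i<n. 2 ^ i * c (x @ [a, a]) i) + (\<Sum>i<n. 2 ^ i * c (x @ [a, b]) i))" for n
    by (subst sum.lessThan_Suc_shift) (simp add: cS sum_distrib_left algebra_simps sum.distrib)
  show ?thesis
  proof (rule zadic2_eq_by_dvd)
    fix n
    let ?S = "\<lambda>n y. \<Sum>i<n. 2 ^ i * c y i"
    have "2 ^ n dvd (Q \<sigma> x - ?S (Suc n) x)"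
      using Q[where n = "Suc n" and y = x] by (metis power_Suc2 dvd_mult_left)
    then have "2 ^ n dvd (Q \<sigma> x - ?S (Suc n) x) - 2 * ((Q \<sigma> (x @ [a, a]) - ?S n (x @ [a, a]))
        + (Q \<sigma> (x @ [a, b]) - ?S n (x @ [a, b])))"
      by (rule dvd_diff[OF _ dvd_mult[OF dvd_add[OF Q Q]]])
    then show "2 ^ n dvd Q \<sigma> x
        - (of_nat (Par \<sigma> x) + 2 * (Q \<sigma> (x @ [a, a]) + Q \<sigma> (x @ [a, b])))"
      unfolding ps c0 by (simp add: algebra_simps)
  qed
qed

section \<open>Tree automorphisms and their sections\<close>

lemma tree_autD:
  assumes "\<sigma> \<in> tree_aut"
  shows "bij \<sigma>" "\<sigma> [] = []" "tree_adj (\<sigma> v) (\<sigma> w) \<longleftrightarrow> tree_adj v w"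
  using assms by (auto simp: tree_aut_def)

lemma tree_aut_snoc_ex:
  assumes "\<sigma> \<in> tree_aut"
  shows "\<exists>t. \<sigma> (w @ [s]) = \<sigma> w @ [t]"
proof (induction w arbitrary: s rule: rev_induct)
  case Nil
  have "tree_adj (\<sigma> []) (\<sigma> [s])"
    unfolding tree_autD(3)[OF assms] by (simp add: tree_adj_def)
  then show ?case by (auto simp: tree_adj_def tree_autD(2)[OF assms])
next
  case (snoc r v)
  have "tree_adj (\<sigma> (v @ [r])) (\<sigma> ((v @ [r]) @ [s]))"
    unfolding tree_autD(3)[OF assms] by (auto simp: tree_adj_def)
  \<comment> \<open>Adjacency is undirected, so moving upwards has to be excluded: the parent of
    \<open>\<sigma> (v @ [r])\<close> is already \<open>\<sigma> v\<close>, and \<sigma> is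
    injective.\<close>
  moreover have "\<sigma> (v @ [r]) \<noteq> \<sigma> ((v @ [r]) @ [s]) @ [t]" for t
  proof
    assume "\<sigma> (v @ [r]) = \<sigma> ((v @ [r]) @ [s]) @ [t]"
    moreover obtain r' where "\<sigma> (v @ [r]) = \<sigma> v @ [r']" using snoc by blast
    ultimately have "\<sigma> ((v @ [r]) @ [s]) = \<sigma> v" by simp
    then have "(v @ [r]) @ [s] = v"
      using bij_is_inj[OF tree_autD(1)[OF assms]] by (simp add: inj_eq)
    then show False by simp
  qed
  ultimately show ?case by (auto simp: tree_adj_def)
qed

lemma letter_neq_iff: "s \<noteq> t \<longleftrightarrow> (s = a \<and> t = b) \<or> (s = b \<and> t = a)"
  by (cases s; cases t) auto

lemma tree_aut_children:
  assumes "\<sigma> \<in> tree_aut"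
  shows "\<sigma> (w @ [a]) = \<sigma> w @ [a] \<and> \<sigma> (w @ [b]) = \<sigma> w @ [b] \<or>
         \<sigma> (w @ [a]) = \<sigma> w @ [b] \<and> \<sigma> (w @ [b]) = \<sigma> w @ [a]"
proof -
  obtain s t where s: "\<sigma> (w @ [a]) = \<sigma> w @ [s]" and t: "\<sigma> (w @ [b]) = \<sigma> w @ [t]"
    using tree_aut_snoc_ex[OF assms] by metis
  have "\<sigma> (w @ [a]) \<noteq> \<sigma> (w @ [b])"
    using bij_is_inj[OF tree_autD(1)[OF assms]] by (simp add: inj_eq)
  then have "s \<noteq> t" using s t by auto
  then show ?thesis using s t unfolding letter_neq_iff by auto
qed

lemma tree_autI:
  assumes nil: "\<sigma> [] = []"
    and ch: "\<And>w. \<sigma> (w @ [a]) = \<sigma> w @ [a] \<and> \<sigma> (w @ [b]) = \<sigma> w @ [b] \<or>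
         \<sigma> (w @ [a]) = \<sigma> w @ [b] \<and> \<sigma> (w @ [b]) = \<sigma> w @ [a]"
  shows "\<sigma> \<in> tree_aut"
proof -
  have ex: "\<exists>t. \<sigma> (w @ [s]) = \<sigma> w @ [t]" for w s
    using ch[of w] by (cases s) auto
  have inj2: "\<sigma> (w @ [s]) = \<sigma> (w @ [t]) \<Longrightarrow> s = t" for w s t
    using ch[of w] by (cases s; cases t) auto
  have onto: "\<exists>t. \<sigma> (w @ [t]) = \<sigma> w @ [s]" for w s
    using ch[of w] by (cases s) blast+
  have len: "length (\<sigma> w) = length w" for w
  proof (induction w rule: rev_induct)
    case (snoc s w)
    then show ?case using ex[of w s] by auto
  qed (simp add: nil)
  have inj_all: "v = w" if "\<sigma> v = \<sigma> w" for v w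
    using that
  proof (induction v arbitrary: w rule: rev_induct)
    case Nil
    then have "length w = 0" using len[of "[]"] len[of w] by (metis list.size(3))
    then show ?case by simp
  next
    case (snoc s v)
    have "length w = Suc (length v)" using snoc.prems len[of w] len[of "v @ [s]"] by simp
    then obtain u t where w: "w = u @ [t]" by (cases w rule: rev_cases) auto
    have "\<sigma> v = \<sigma> u" using snoc.prems ex[of v s] ex[of u t] w by auto
    then have "v = u" by (rule snoc.IH)
    then show ?case using snoc.prems inj2[of v s t] w by simp
  qed
  have surj: "\<exists>v. \<sigma> v = w" for w
  proof (induction w rule: rev_induct)
    case Nil
    show ?case using nil by blast
  next
    case (snoc s w)
    then obtain v where "\<sigma> v = w" by blast
    then show ?case using onto[of v s] by blast
  qed
  have "bij \<sigma>" unfolding bij_def inj_def surj_def using inj_all surj by metis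
  moreover have "(\<exists>s. \<sigma> w = \<sigma> v @ [s]) \<longleftrightarrow> (\<exists>s. w = v @ [s])" for v w
  proof
    assume "\<exists>s. \<sigma> w = \<sigma> v @ [s]"
    then obtain s where s: "\<sigma> w = \<sigma> v @ [s]" by blast
    obtain t where "\<sigma> (v @ [t]) = \<sigma> v @ [s]" using onto by blast
    then show "\<exists>s. w = v @ [s]" using s inj_all by metis
  qed (use ex in blast)
  ultimately show ?thesis by (simp add: tree_aut_def tree_adj_def nil ex_disj_distrib)
qed

lemma tree_aut_length [simp]:
  assumes "\<sigma> \<in> tree_aut"
  shows "length (\<sigma> w) = length w"
proof (induction w rule: rev_induct)
  case (snoc s w)
  then show ?case using tree_aut_snoc_ex[OF assms, of w s] by auto
qed (simp add: tree_autD(2)[OF assms])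

lemma tree_aut_id [simp]: "id \<in> tree_aut"
  by (rule tree_autI) auto

lemma tree_aut_comp [simp]:
  assumes "\<sigma> \<in> tree_aut" "\<tau> \<in> tree_aut"
  shows "\<sigma> \<circ> \<tau> \<in> tree_aut"
  using assms by (auto simp: tree_aut_def bij_comp)

lemma tree_aut_inv [simp]:
  assumes "\<sigma> \<in> tree_aut"
  shows "inv_into UNIV \<sigma> \<in> tree_aut"
proof -
  note bij = tree_autD(1)[OF assms]
  have "tree_adj (inv_into UNIV \<sigma> v) (inv_into UNIV \<sigma> w) \<longleftrightarrow> tree_adj v w" for v w
    using tree_autD(3)[OF assms, of "inv_into UNIV \<sigma> v" "inv_into UNIV \<sigma> w"] bij by (simp add: bij_is_surj surj_f_inv_f)
  moreover have "inv_into UNIV \<sigma> [] = []"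
    using tree_autD(2)[OF assms] bij by (metis bij_is_inj inv_f_f)
  ultimately show ?thesis using bij by (simp add: tree_aut_def bij_imp_bij_inv)
qed

lemma tree_aut_inv_comp [simp]:
  assumes "\<sigma> \<in> tree_aut"
  shows "inv_into UNIV \<sigma> \<circ> \<sigma> = id" "\<sigma> \<circ> inv_into UNIV \<sigma> = id"
  using tree_autD(1)[OF assms] by (simp_all add: bij_is_inj bij_is_surj surj_iff[symmetric])

text \<open>The section (state) of self-similar group theory: the map induced from the subtree below
  \<open>x\<close> to the one below \<open>\<sigma> x\<close>, both identified with the whole tree.
  Dropping \<open>length x\<close> letters is right because automorphisms preserve length.\<close>

definition sec :: "(node \<Rightarrow> node) \<Rightarrow> node \<Rightarrow> node \<Rightarrow> node" where
  "sec \<sigma> x w = drop (length x) (\<sigma> (x @ w))"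

lemma tree_aut_append:
  assumes "\<sigma> \<in> tree_aut"
  shows "\<sigma> (x @ w) = \<sigma> x @ sec \<sigma> x w"
proof -
  have "take (length x) (\<sigma> (x @ w)) = \<sigma> x"
  proof (induction w rule: rev_induct)
    case (snoc s w)
    then show ?case
      using tree_aut_snoc_ex[OF assms, of "x @ w" s] assms by auto
  qed (simp add: assms)
  then show ?thesis unfolding sec_def by (metis append_take_drop_id)
qed

lemma sec_tree_aut [simp]:
  assumes "\<sigma> \<in> tree_aut"
  shows "sec \<sigma> x \<in> tree_aut"
proof (rule tree_autI)
  show "sec \<sigma> x [] = []" using assms by (simp add: sec_def)
  show "sec \<sigma> x (w @ [a]) = sec \<sigma> x w @ [a] \<and> sec \<sigma> x (w @ [b]) = sec \<sigma> x w @ [b] \<or>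
        sec \<sigma> x (w @ [a]) = sec \<sigma> x w @ [b] \<and> sec \<sigma> x (w @ [b]) = sec \<sigma> x w @ [a]" for w
    using tree_aut_children[OF assms, of "x @ w"] assms
    unfolding sec_def by auto
qed

lemma sec_comp:
  assumes "\<sigma> \<in> tree_aut" "\<tau> \<in> tree_aut"
  shows "sec (\<sigma> \<circ> \<tau>) x = sec \<sigma> (\<tau> x) \<circ> sec \<tau> x"
proof
  fix w
  show "sec (\<sigma> \<circ> \<tau>) x w = (sec \<sigma> (\<tau> x) \<circ> sec \<tau> x) w"
    using tree_aut_append[OF assms(2), of x w] assms(2) by (simp add: sec_def[of \<sigma>] sec_def[of "\<sigma> \<circ> \<tau>"])
qed

lemma sec_sec: "sec (sec \<sigma> x) y = sec \<sigma> (x @ y)"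
  by (rule ext) (simp add: sec_def add.commute)

lemma sec_Nil [simp]: "sec \<sigma> [] = \<sigma>"
  by (rule ext) (simp add: sec_def)

lemma Par_sec:
  assumes "\<sigma> \<in> tree_aut"
  shows "Par (sec \<sigma> x) y = Par \<sigma> (x @ y)"
  unfolding Par_def
  using tree_aut_append[OF assms, of x "y @ [a]"] tree_aut_append[OF assms, of x "y @ [b]"]
    tree_aut_append[OF assms, of x y] by simp

lemma Q_sec:
  assumes "\<sigma> \<in> tree_aut"
  shows "Q (sec \<sigma> x) y = Q \<sigma> (x @ y)"
  unfolding Q_def by (simp add: Par_sec[OF assms])

lemma P_sec:
  assumes "\<sigma> \<in> tree_aut"
  shows "P (sec \<sigma> x) y = P \<sigma> (x @ y)"
  unfolding P_def by (simp add: Par_sec[OF assms] Q_sec[OF assms])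

lemma Par_cases:
  assumes "\<sigma> \<in> tree_aut"
  obtains (stay) "Par \<sigma> x = 0" "\<sigma> (x @ [a]) = \<sigma> x @ [a]" "\<sigma> (x @ [b]) = \<sigma> x @ [b]"
    | (swap) "Par \<sigma> x = 1" "\<sigma> (x @ [a]) = \<sigma> x @ [b]" "\<sigma> (x @ [b]) = \<sigma> x @ [a]"
proof (cases "\<sigma> (x @ [a]) = \<sigma> x @ [a] \<and> \<sigma> (x @ [b]) = \<sigma> x @ [b]")
  case True
  then show ?thesis using stay by (simp add: Par_def)
next
  case False
  then show ?thesis
    using swap tree_aut_children[OF assms, of x] by (auto simp: Par_def)
qed

lemma Par_root_cases:
  assumes "\<sigma> \<in> tree_aut"
  obtains (stay) "Par \<sigma> [] = 0" "\<sigma> [a] = [a]" "\<sigma> [b] = [b]"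
    | (swap) "Par \<sigma> [] = 1" "\<sigma> [a] = [b]" "\<sigma> [b] = [a]"
proof (rule Par_cases[OF assms, of "[]"])
qed (use stay swap in \<open>simp_all add: tree_autD(2)[OF assms]\<close>)

lemma Par_comp_root:
  assumes "\<sigma> \<in> tree_aut" "\<tau> \<in> tree_aut"
  shows "Par (\<sigma> \<circ> \<tau>) [] = (if Par \<tau> [] = 0 then Par \<sigma> [] else 1 - Par \<sigma> [])"
  using assms[THEN tree_autD(2)]
  by (rule_tac Par_root_cases[OF assms(1)]; rule_tac Par_root_cases[OF assms(2)]) (auto simp: Par_def)

text \<open>\<open>R\<close> plays for the second generator of the group the role that \<open>Q\<close> plays for the first:
  on words in the two generators defined below, \<open>Q\<close> and \<open>R\<close> are the two exponent sums.\<close>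

definition R :: "(node \<Rightarrow> node) \<Rightarrow> zadic2" where
  "R \<sigma> = Q \<sigma> [a] + Q \<sigma> [b]"

lemma R_eq:
  assumes "\<sigma> \<in> tree_aut"
  shows "R \<sigma> = Q (sec \<sigma> [a]) [] + Q (sec \<sigma> [b]) []"
  by (simp add: R_def Q_sec[OF assms])

lemma Q_root:
  assumes "\<sigma> \<in> tree_aut"
  shows "Q \<sigma> [] = of_nat (Par \<sigma> []) + 2 * R (sec \<sigma> [a])"
  by (subst Q_rec) (simp add: R_def Q_sec[OF assms])

lemma P_root:
  assumes "\<sigma> \<in> tree_aut"
  shows "P \<sigma> [] = (- 1) ^ Par \<sigma> [] + 2 * R (sec \<sigma> [b]) - 2 * R (sec \<sigma> [a])"
  by (simp add: R_def P_def Q_sec[OF assms])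

lemma P_odd:
  assumes "\<sigma> \<in> tree_aut"
  shows "2 dvd P \<sigma> [] - 1"
proof -
  have "2 dvd ((- 1) ^ Par \<sigma> [] - 1 :: zadic2)"
    by (rule Par_root_cases[OF assms]) simp_all
  moreover have "P \<sigma> [] - 1 = ((- 1) ^ Par \<sigma> [] - 1) + 2 * (R (sec \<sigma> [b]) - R (sec \<sigma> [a]))"
    unfolding P_root[OF assms] by (simp add: algebra_simps)
  ultimately show ?thesis by (simp only: dvd_add dvd_triv_left)
qed

section \<open>The cocycle property\<close>

definition M_set :: "(node \<Rightarrow> node) set" where
  "M_set = {\<sigma> \<in> tree_aut. \<forall>x. P \<sigma> x = P \<sigma> []}"

lemma M_set_tree_aut: "\<sigma> \<in> M_set \<Longrightarrow> \<sigma> \<in> tree_aut"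
  by (simp add: M_set_def)

lemma M_set_P:
  assumes "\<sigma> \<in> M_set"
  shows "P \<sigma> x = P \<sigma> []"
proof -
  have "\<forall>x. P \<sigma> x = P \<sigma> []" using assms unfolding M_set_def by (rule CollectE) (rule conjunct2)
  then show ?thesis by (rule spec)
qed

lemma M_setI:
  assumes "\<sigma> \<in> tree_aut" "\<And>x. P \<sigma> x = c"
  shows "\<sigma> \<in> M_set"
  using assms by (simp add: M_set_def)

lemma sec_M_set:
  assumes "\<sigma> \<in> M_set"
  shows "sec \<sigma> x \<in> M_set" "P (sec \<sigma> x) [] = P \<sigma> []"
proof -
  note \<sigma> = M_set_tree_aut[OF assms]
  show "P (sec \<sigma> x) [] = P \<sigma> []" using \<sigma> M_set_P[OF assms, of x] by (simp add: P_sec)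
  show "sec \<sigma> x \<in> M_set"
    by (rule M_setI[of _ "P \<sigma> []"]) (use \<sigma> M_set_P[OF assms, of "x @ _"] in \<open>simp_all add: P_sec\<close>)
qed

text \<open>If \<tau> swaps the children of the root, the flipped parity and the exchanged section
  of \<sigma> change the result by \<open>(- 1) ^ Par \<sigma> [] + 2 * R (sec \<sigma> [b]) - 2 * R
  (sec \<sigma> [a])\<close>, which is \<open>P \<sigma> []\<close>. Sections of an element of
  \<open>M_set\<close> keep its value of \<open>P\<close>, so the hypothesis of the induction has
  the same scalar.\<close>

lemma Q_comp:
  assumes "\<sigma> \<in> M_set" "\<tau> \<in> tree_aut"
  shows "Q (\<sigma> \<circ> \<tau>) [] = Q \<sigma> [] + P \<sigma> [] * Q \<tau> []"
proof (rule zadic2_eq_by_dvd)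
  fix n
  show "2 ^ n dvd (Q (\<sigma> \<circ> \<tau>) [] - (Q \<sigma> [] + P \<sigma> [] * Q \<tau> []))"
    using assms
  proof (induction n arbitrary: \<sigma> \<tau>)
    case (Suc n)
    \<comment> \<open>Passing from \<open>Q\<close> of the sections to \<open>R\<close> keeps the
      precision; the factor 2 in \<open>Q_root\<close> then gains the missing power.\<close>
    have Rc: "2 ^ n dvd (R (\<sigma> \<circ> \<tau>) - (R \<sigma> + P \<sigma> [] * R \<tau>))"
      if \<sigma>M: "\<sigma> \<in> M_set" and \<tau>: "\<tau> \<in> tree_aut" for \<sigma> \<tau>
    proof -
      have \<sigma>: "\<sigma> \<in> tree_aut" using \<sigma>M by (rule M_set_tree_aut)
      have "2 ^ n dvd (Q (sec \<sigma> (\<tau> [s]) \<circ> sec \<tau> [s]) []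
          - (Q (sec \<sigma> (\<tau> [s])) [] + P \<sigma> [] * Q (sec \<tau> [s]) []))" for s
        using Suc.IH[of "sec \<sigma> (\<tau> [s])" "sec \<tau> [s]"] sec_M_set[OF \<sigma>M] \<tau> by (simp del: o_apply)
      from dvd_add[OF this[of a] this[of b]] show ?thesis
        by - (rule Par_root_cases[OF \<tau>],
          simp_all add: R_eq \<sigma> \<tau> sec_comp algebra_simps)
    qed
    note \<sigma>M = Suc.prems(1) and \<tau> = Suc.prems(2)
    have \<sigma>: "\<sigma> \<in> tree_aut" using \<sigma>M by (rule M_set_tree_aut)
    have "2 ^ n dvd (R (sec \<sigma> (\<tau> [a]) \<circ> sec \<tau> [a])
          - (R (sec \<sigma> (\<tau> [a])) + P \<sigma> [] * R (sec \<tau> [a])))"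
      using Rc[of "sec \<sigma> (\<tau> [a])" "sec \<tau> [a]"] sec_M_set[OF \<sigma>M] \<tau> by (simp del: o_apply)
    then have *: "2 ^ Suc n dvd 2 * (R (sec \<sigma> (\<tau> [a]) \<circ> sec \<tau> [a])
          - (R (sec \<sigma> (\<tau> [a])) + P \<sigma> [] * R (sec \<tau> [a])))"
      by (simp only: zadic2_cancel_2)
    have "Q (\<sigma> \<circ> \<tau>) [] - (Q \<sigma> [] + P \<sigma> [] * Q \<tau> []) = 2 * (R (sec \<sigma> (\<tau> [a]) \<circ> sec \<tau> [a])
          - (R (sec \<sigma> (\<tau> [a])) + P \<sigma> [] * R (sec \<tau> [a])))"
    proof (rule Par_root_cases[OF \<tau>])
      assume t: "Par \<tau> [] = 0" "\<tau> [a] = [a]" "\<tau> [b] = [b]"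
      have "Par (\<sigma> \<circ> \<tau>) [] = Par \<sigma> []" using t \<sigma> \<tau> by (simp add: Par_comp_root)
      then show ?thesis
        using t by (simp add: Q_root \<sigma> \<tau> sec_comp algebra_simps)
    next
      assume t: "Par \<tau> [] = 1" "\<tau> [a] = [b]" "\<tau> [b] = [a]"
      have "Par (\<sigma> \<circ> \<tau>) [] = 1 - Par \<sigma> []"
        using t \<sigma> \<tau> by (simp add: Par_comp_root)
      then show ?thesis
        using t P_root[OF \<sigma>]
        by - (rule Par_root_cases[OF \<sigma>], simp_all add: Q_root \<sigma> \<tau> sec_comp algebra_simps)
    qed
    then show ?case using * by (simp only:)
  qed simp
qed

lemma R_comp:
  assumes \<sigma>M: "\<sigma> \<in> M_set" and \<tau>: "\<tau> \<in> tree_aut"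
  shows "R (\<sigma> \<circ> \<tau>) = R \<sigma> + P \<sigma> [] * R \<tau>"
proof -
  have \<sigma>: "\<sigma> \<in> tree_aut" using \<sigma>M by (rule M_set_tree_aut)
  have "Q (sec \<sigma> (\<tau> [s]) \<circ> sec \<tau> [s]) [] = Q (sec \<sigma> (\<tau> [s])) [] + P \<sigma> [] * Q (sec \<tau> [s]) []" for s
    using Q_comp[of "sec \<sigma> (\<tau> [s])" "sec \<tau> [s]"] sec_M_set[OF \<sigma>M] \<tau> by (simp del: o_apply)
  from this[of a] this[of b] show ?thesis
    by - (rule Par_root_cases[OF \<tau>], simp_all add: R_eq \<sigma> \<tau> sec_comp algebra_simps)
qed

text \<open>A swap by \<tau> reverses the sign and exchanges the two sections of \<sigma>, so the
  contribution of \<sigma> becomes \<open>- P \<sigma> []\<close>, in accordance with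
  \<open>(- 1) ^ Par \<tau> []\<close>.\<close>

lemma P_comp_root:
  assumes \<sigma>M: "\<sigma> \<in> M_set" and \<tau>: "\<tau> \<in> tree_aut"
  shows "P (\<sigma> \<circ> \<tau>) [] = P \<sigma> [] * P \<tau> []"
proof -
  have \<sigma>: "\<sigma> \<in> tree_aut" using \<sigma>M by (rule M_set_tree_aut)
  have Rs: "R (sec \<sigma> (\<tau> [s]) \<circ> sec \<tau> [s]) = R (sec \<sigma> (\<tau> [s])) + P \<sigma> [] * R (sec \<tau> [s])" for s
    using R_comp[of "sec \<sigma> (\<tau> [s])" "sec \<tau> [s]"] sec_M_set[OF \<sigma>M] \<tau> by (simp del: o_apply)
  have P1: "P (\<sigma> \<circ> \<tau>) [] = (- 1) ^ Par (\<sigma> \<circ> \<tau>) []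
      + 2 * (R (sec \<sigma> (\<tau> [b])) + P \<sigma> [] * R (sec \<tau> [b]))
      - 2 * (R (sec \<sigma> (\<tau> [a])) + P \<sigma> [] * R (sec \<tau> [a]))"
    using \<sigma> \<tau> by (simp add: P_root sec_comp Rs)
  have P2: "P \<sigma> [] * P \<tau> [] = P \<sigma> [] * (- 1) ^ Par \<tau> []
      + 2 * P \<sigma> [] * R (sec \<tau> [b]) - 2 * P \<sigma> [] * R (sec \<tau> [a])"
    by (simp add: P_root[OF \<tau>] algebra_simps)
  show ?thesis
  proof (rule Par_root_cases[OF \<tau>])
    assume t: "Par \<tau> [] = 0" "\<tau> [a] = [a]" "\<tau> [b] = [b]"
    have "Par (\<sigma> \<circ> \<tau>) [] = Par \<sigma> []" using t \<sigma> \<tau> by (simp add: Par_comp_root)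
    then have "P (\<sigma> \<circ> \<tau>) [] = P \<sigma> [] + 2 * P \<sigma> [] * R (sec \<tau> [b]) - 2 * P \<sigma> [] * R (sec \<tau> [a])"
      using t unfolding P1 by (subst (2) P_root[OF \<sigma>]) (simp add: algebra_simps)
    then show ?thesis unfolding P2 by (simp add: t)
  next
    assume t: "Par \<tau> [] = 1" "\<tau> [a] = [b]" "\<tau> [b] = [a]"
    have "Par (\<sigma> \<circ> \<tau>) [] = 1 - Par \<sigma> []"
      using t \<sigma> \<tau> by (simp add: Par_comp_root)
    then have e: "(- 1) ^ Par (\<sigma> \<circ> \<tau>) [] = (- ((- 1) ^ Par \<sigma> []) :: zadic2)"
      by - (rule Par_root_cases[OF \<sigma>], simp_all)
    show ?thesis unfolding P1 P2 e t using P_root[OF \<sigma>] by (simp add: algebra_simps)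
  qed
qed

lemma P_comp:
  assumes \<sigma>M: "\<sigma> \<in> M_set" and \<tau>: "\<tau> \<in> tree_aut"
  shows "P (\<sigma> \<circ> \<tau>) x = P \<sigma> [] * P \<tau> x"
proof -
  have \<sigma>: "\<sigma> \<in> tree_aut" using \<sigma>M by (rule M_set_tree_aut)
  have "P (\<sigma> \<circ> \<tau>) x = P (sec \<sigma> (\<tau> x) \<circ> sec \<tau> x) []"
    using P_sec[of "\<sigma> \<circ> \<tau>" x "[]"] \<sigma> \<tau> by (simp add: sec_comp)
  also have "\<dots> = P \<sigma> [] * P \<tau> x"
    using P_comp_root[of "sec \<sigma> (\<tau> x)" "sec \<tau> x"] sec_M_set[OF \<sigma>M] \<tau> P_sec[OF \<tau>, of x "[]"]
    by simp
  finally show ?thesis .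
qed

section \<open>Closure of \<open>M_set\<close> under composition and inversion\<close>

lemma Par_id [simp]: "Par id x = 0"
  by (simp add: Par_def)

lemma Q_id [simp]: "Q id x = 0"
  by (simp add: Q_def)

lemma R_id [simp]: "R id = 0"
  by (simp add: R_def)

lemma P_id [simp]: "P id x = 1"
  by (simp add: P_def)

lemma M_set_id [simp]: "id \<in> M_set"
  by (simp add: M_set_def)

lemma M_set_comp [simp]:
  assumes "\<sigma> \<in> M_set" "\<tau> \<in> M_set"
  shows "\<sigma> \<circ> \<tau> \<in> M_set"
proof (rule M_setI)
  show "\<sigma> \<circ> \<tau> \<in> tree_aut" using assms by (simp add: M_set_tree_aut)
  show "P (\<sigma> \<circ> \<tau>) x = P \<sigma> [] * P \<tau> []" for x
    by (simp only: P_comp[OF assms(1) M_set_tree_aut[OF assms(2)]] M_set_P[OF assms(2), of x])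
qed

lemma M_set_inv [simp]:
  assumes "\<sigma> \<in> M_set"
  shows "inv_into UNIV \<sigma> \<in> M_set"
proof (rule M_setI)
  let ?\<tau> = "inv_into UNIV \<sigma>"
  note \<sigma> = M_set_tree_aut[OF assms]
  then show "?\<tau> \<in> tree_aut" by simp
  have one: "P \<sigma> [] * P ?\<tau> x = 1" for x
    using P_comp[OF assms tree_aut_inv[OF \<sigma>], of x] by (simp only: tree_aut_inv_comp[OF \<sigma>] P_id)
  show "P ?\<tau> x = P ?\<tau> []" for x
  proof -
    have "P ?\<tau> x = P ?\<tau> x * (P \<sigma> [] * P ?\<tau> [])" by (simp only: one mult_1_right)
    also have "\<dots> = (P \<sigma> [] * P ?\<tau> x) * P ?\<tau> []" by (simp only: mult_ac)
    finally show ?thesis by (simp only: one mult_1_left)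
  qed
qed

lemma carrier_M_inf: "carrier M_inf = M_set"
  by (simp add: M_inf_def M_set_def)

lemma mult_M_inf [simp]: "mult M_inf = (\<circ>)"
  by (simp add: M_inf_def)

lemma one_M_inf [simp]: "one M_inf = id"
  by (simp add: M_inf_def)

lemma group_M_inf: "group M_inf"
proof (rule groupI)
  fix \<sigma> assume "\<sigma> \<in> carrier M_inf"
  then have "inv_into UNIV \<sigma> \<in> carrier M_inf" "inv_into UNIV \<sigma> \<otimes>\<^bsub>M_inf\<^esub> \<sigma> = \<one>\<^bsub>M_inf\<^esub>"
    by (simp_all add: carrier_M_inf M_set_tree_aut)
  then show "\<exists>\<tau>\<in>carrier M_inf. \<tau> \<otimes>\<^bsub>M_inf\<^esub> \<sigma> = \<one>\<^bsub>M_inf\<^esub>" by blast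
qed (simp_all add: carrier_M_inf comp_assoc)

interpretation M: group M_inf
  rewrites "carrier M_inf = M_set" and "mult M_inf = (\<circ>)" and "one M_inf = id"
  by (rule group_M_inf) (simp_all add: carrier_M_inf)

lemma inv_M_inf:
  assumes "\<sigma> \<in> M_set"
  shows "inv\<^bsub>M_inf\<^esub> \<sigma> = inv_into UNIV \<sigma>"
  using M.inv_equality[of "inv_into UNIV \<sigma>" \<sigma>] assms by (simp add: M_set_tree_aut)

section \<open>The two generators of the kernel of P\<close>

text \<open>Together with \<open>id\<close> these are the states of an automaton of the basilica
  group, the iterated monodromy group of \<open>z^2 - 1\<close>. Their mutual recursion mirrors the
  one between \<open>Q\<close> and \<open>R\<close>.\<close>

fun gen_a gen_b :: "node \<Rightarrow> node" where
  "gen_a [] = []"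
| "gen_a (a # w) = b # w"
| "gen_a (b # w) = a # gen_b w"
| "gen_b [] = []"
| "gen_b (a # w) = a # gen_a w"
| "gen_b (b # w) = b # w"

lemma gen_children:
  "gen_a (w @ [a]) = gen_a w @ [a] \<and> gen_a (w @ [b]) = gen_a w @ [b] \<or>
   gen_a (w @ [a]) = gen_a w @ [b] \<and> gen_a (w @ [b]) = gen_a w @ [a]"
  "gen_b (w @ [a]) = gen_b w @ [a] \<and> gen_b (w @ [b]) = gen_b w @ [b] \<or>
   gen_b (w @ [a]) = gen_b w @ [b] \<and> gen_b (w @ [b]) = gen_b w @ [a]"
proof -
  have "(gen_a (w @ [a]) = gen_a w @ [a] \<and> gen_a (w @ [b]) = gen_a w @ [b] \<or>
         gen_a (w @ [a]) = gen_a w @ [b] \<and> gen_a (w @ [b]) = gen_a w @ [a]) \<and>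
        (gen_b (w @ [a]) = gen_b w @ [a] \<and> gen_b (w @ [b]) = gen_b w @ [b] \<or>
         gen_b (w @ [a]) = gen_b w @ [b] \<and> gen_b (w @ [b]) = gen_b w @ [a])"
  proof (induction w)
    case (Cons c w)
    then show ?case by (cases c) auto
  qed simp
  then show "gen_a (w @ [a]) = gen_a w @ [a] \<and> gen_a (w @ [b]) = gen_a w @ [b] \<or>
      gen_a (w @ [a]) = gen_a w @ [b] \<and> gen_a (w @ [b]) = gen_a w @ [a]"
    "gen_b (w @ [a]) = gen_b w @ [a] \<and> gen_b (w @ [b]) = gen_b w @ [b] \<or>
      gen_b (w @ [a]) = gen_b w @ [b] \<and> gen_b (w @ [b]) = gen_b w @ [a]" by blast+
qed

lemma gen_tree_aut [simp]: "gen_a \<in> tree_aut" "gen_b \<in> tree_aut"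
  by (rule tree_autI, simp, rule gen_children)+

lemma sec_gen [simp]:
  "sec gen_a [a] = id" "sec gen_a [b] = gen_b" "sec gen_b [a] = gen_a" "sec gen_b [b] = id"
  by (auto simp: sec_def fun_eq_iff)

lemma Par_gen [simp]: "Par gen_a [] = 1" "Par gen_b [] = 0"
  by (simp_all add: Par_def)

text \<open>The recursion closes up to \<open>R gen_a = 2 * R gen_a\<close>, which forces the two
  zeros.\<close>

lemma QR_gen [simp]: "Q gen_a [] = 1" "Q gen_b [] = 0" "R gen_a = 0" "R gen_b = 1"
proof -
  have "R gen_a = Q gen_b []" by (simp add: R_eq)
  moreover have "Q gen_b [] = 2 * R gen_a" by (simp add: Q_root)
  ultimately show *: "Q gen_b [] = 0" "R gen_a = 0" by auto
  show "Q gen_a [] = 1" by (simp add: Q_root)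
  then show "R gen_b = 1" by (simp add: R_eq)
qed

lemma P_gen [simp]: "P gen_a x = 1" "P gen_b x = 1"
proof -
  have "P gen_a x = 1 \<and> P gen_b x = 1"
  proof (induction x)
    case Nil
    show ?case by (simp add: P_root)
  next
    case (Cons c x)
    have "P \<sigma> (c # x) = P (sec \<sigma> [c]) x" if "\<sigma> \<in> tree_aut" for \<sigma>
      using P_sec[OF that, of "[c]" x] by simp
    then show ?case using Cons by (cases c) simp_all
  qed
  then show "P gen_a x = 1" "P gen_b x = 1" by auto
qed

lemma gen_M_set [simp]: "gen_a \<in> M_set" "gen_b \<in> M_set"
  by (rule M_setI[where c = 1]; simp)+

lemma gen_b_pow [simp]:
  "gen_b ^^ k \<in> M_set" "P (gen_b ^^ k) [] = 1" "Q (gen_b ^^ k) [] = 0" "R (gen_b ^^ k) = of_nat k"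
proof -
  have "gen_b ^^ k \<in> M_set \<and> P (gen_b ^^ k) [] = 1 \<and> Q (gen_b ^^ k) [] = 0 \<and> R (gen_b ^^ k) = of_nat k"
  proof (induction k)
    case 0
    show ?case by (simp add: id_def[symmetric])
  next
    case (Suc k)
    then have "gen_b ^^ k \<in> tree_aut" by (simp add: M_set_tree_aut)
    then show ?case using Suc by (simp add: P_comp_root Q_comp R_comp del: o_apply)
  qed
  then show "gen_b ^^ k \<in> M_set" "P (gen_b ^^ k) [] = 1" "Q (gen_b ^^ k) [] = 0"
    "R (gen_b ^^ k) = of_nat k" by auto
qed

section \<open>Elements with prescribed value of P\<close>

text \<open>The self-similar definition makes \<open>P\<close> at the root equal to
  \<open>1 + 2 * (R (gen_b ^^ k \<circ> dil k) - R (dil k)) = 1 + 2 * k\<close>.\<close>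

fun dil :: "nat \<Rightarrow> node \<Rightarrow> node" where
  "dil k [] = []"
| "dil k (a # w) = a # dil k w"
| "dil k (b # w) = b # (gen_b ^^ k) (dil k w)"

lemma dil_tree_aut [simp]: "dil k \<in> tree_aut"
proof (rule tree_autI)
  fix w
  show "dil k (w @ [a]) = dil k w @ [a] \<and> dil k (w @ [b]) = dil k w @ [b] \<or>
        dil k (w @ [a]) = dil k w @ [b] \<and> dil k (w @ [b]) = dil k w @ [a]"
  proof (induction k w rule: dil.induct)
    case (3 k w)
    then show ?case
      using tree_aut_children[OF M_set_tree_aut[OF gen_b_pow(1)[of k]], of "dil k w"] by auto
  next
    case (1 k)
    show ?case
      using tree_autD(2)[OF M_set_tree_aut[OF gen_b_pow(1)[of k]]] by simp
  qed simp
qed simp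

lemma sec_dil [simp]: "sec (dil k) [a] = dil k" "sec (dil k) [b] = gen_b ^^ k \<circ> dil k"
  by (auto simp: sec_def fun_eq_iff)

lemma Par_dil [simp]: "Par (dil k) [] = 0"
  using tree_autD(2)[OF M_set_tree_aut[OF gen_b_pow(1)[of k]]] by (simp add: Par_def)

lemma P_dil [simp]: "P (dil k) x = 1 + 2 * of_nat k"
proof (induction x)
  case Nil
  show ?case by (simp add: P_root R_comp algebra_simps)
next
  case (Cons c x)
  have "P (dil k) (c # x) = P (sec (dil k) [c]) x"
    using P_sec[OF dil_tree_aut, of k "[c]" x] by simp
  then show ?case using Cons by (cases c) (simp_all add: P_comp)
qed

lemma dil_M_set [simp]: "dil k \<in> M_set"
  by (rule M_setI) simp_all

text \<open>So \<open>dil k\<close> adjusts \<open>P\<close> without disturbing the parities of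
  \<open>Q\<close> and \<open>R\<close>.\<close>

lemma QR_dil_even: "2 dvd Q (dil k) []" "2 dvd R (dil k)"
proof -
  show "2 dvd Q (dil k) []" by (simp add: Q_root)
  then show "2 dvd R (dil k)" by (simp add: R_eq Q_comp)
qed

section \<open>Automorphisms fixing the first level\<close>

definition pair :: "(node \<Rightarrow> node) \<Rightarrow> (node \<Rightarrow> node) \<Rightarrow> node \<Rightarrow> node" where
  "pair g h w = (case w of [] \<Rightarrow> [] | c # v \<Rightarrow> c # (if c = a then g v else h v))"

lemma pair_simps [simp]:
  "pair g h [] = []" "pair g h (a # w) = a # g w" "pair g h (b # w) = b # h w"
  by (simp_all add: pair_def)

lemma node_cases: obtains "w = []" | v where "w = a # v" | v where "w = b # v"
  by (metis letter.exhaust neq_Nil_conv)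

lemma pair_id [simp]: "pair id id = id"
proof
  show "pair id id w = id w" for w by (cases w rule: node_cases) auto
qed

lemma pair_comp: "pair g h \<circ> pair g' h' = pair (g \<circ> g') (h \<circ> h')"
proof
  show "(pair g h \<circ> pair g' h') w = pair (g \<circ> g') (h \<circ> h') w" for w
    by (cases w rule: node_cases) auto
qed

lemma pair_sec:
  assumes "\<sigma> \<in> tree_aut" "Par \<sigma> [] = 0"
  shows "\<sigma> = pair (sec \<sigma> [a]) (sec \<sigma> [b])"
proof
  fix w
  have "\<sigma> [a] = [a]" "\<sigma> [b] = [b]" using Par_root_cases[OF assms(1)] assms(2) by auto
  then show "\<sigma> w = pair (sec \<sigma> [a]) (sec \<sigma> [b]) w"
    using tree_aut_append[OF assms(1), of "[a]"] tree_aut_append[OF assms(1), of "[b]"]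
      tree_autD(2)[OF assms(1)]
    by (cases w rule: node_cases) auto
qed

lemma sec_pair [simp]: "sec (pair g h) [a] = g" "sec (pair g h) [b] = h"
  by (simp_all add: sec_def fun_eq_iff)

lemma gen_b_pair: "gen_b = pair gen_a id"
proof
  show "gen_b w = pair gen_a id w" for w by (cases w rule: node_cases) auto
qed

lemma gen_a_sq: "gen_a \<circ> gen_a = pair gen_b gen_b"
proof
  show "(gen_a \<circ> gen_a) w = pair gen_b gen_b w" for w by (cases w rule: node_cases) auto
qed

lemma gen_a_conj: "gen_a \<circ> gen_b = pair id gen_a \<circ> gen_a"
proof
  show "(gen_a \<circ> gen_b) w = (pair id gen_a \<circ> gen_a) w" for w by (cases w rule: node_cases) auto
qed

lemma pair_pow: "pair g h ^^ k = pair (g ^^ k) (h ^^ k)"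
  by (induction k) (simp_all add: pair_comp id_def[symmetric] del: o_apply)

lemma gen_a_even_pow: "gen_a ^^ (2 * k) = pair (gen_b ^^ k) (gen_b ^^ k)"
proof -
  have "gen_a ^^ (2 * k) = (gen_a ^^ 2) ^^ k" by (simp add: funpow_mult mult.commute)
  also have "gen_a ^^ 2 = pair gen_b gen_b" by (simp add: gen_a_sq numeral_2_eq_2)
  finally show ?thesis by (simp add: pair_pow)
qed

section \<open>Congruence modulo level stabilizers\<close>

definition agree :: "nat \<Rightarrow> (node \<Rightarrow> node) \<Rightarrow> (node \<Rightarrow> node) \<Rightarrow> bool" where
  "agree n \<sigma> \<tau> \<longleftrightarrow> (\<forall>w. length w \<le> n \<longrightarrow> \<sigma> w = \<tau> w)"

lemma agree_refl [simp]: "agree n \<sigma> \<sigma>"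
  by (simp add: agree_def)

lemma agree_sym: "agree n \<sigma> \<tau> \<Longrightarrow> agree n \<tau> \<sigma>"
  by (simp add: agree_def)

lemma agree_trans: "agree n \<sigma> \<tau> \<Longrightarrow> agree n \<tau> \<rho> \<Longrightarrow> agree n \<sigma> \<rho>"
  by (simp add: agree_def)

lemma agree_mono: "agree n \<sigma> \<tau> \<Longrightarrow> m \<le> n \<Longrightarrow> agree m \<sigma> \<tau>"
  by (simp add: agree_def)

lemma agree_comp:
  assumes "agree n \<sigma> \<sigma>'" "agree n \<tau> \<tau>'" "\<tau> \<in> tree_aut"
  shows "agree n (\<sigma> \<circ> \<tau>) (\<sigma>' \<circ> \<tau>')"
  unfolding agree_def
proof (intro allI impI)
  fix w :: node assume w: "length w \<le> n"
  then have "\<tau> w = \<tau>' w" using assms(2) by (simp add: agree_def)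
  moreover have "\<sigma> (\<tau> w) = \<sigma>' (\<tau> w)" using assms(1,3) w by (simp add: agree_def)
  ultimately show "(\<sigma> \<circ> \<tau>) w = (\<sigma>' \<circ> \<tau>') w" by simp
qed

lemma agree_pair:
  assumes "agree n g g'" "agree n h h'"
  shows "agree (Suc n) (pair g h) (pair g' h')"
  unfolding agree_def
proof (intro allI impI)
  fix w :: node assume "length w \<le> Suc n"
  then show "pair g h w = pair g' h' w"
    using assms by (cases w rule: node_cases) (auto simp: agree_def)
qed

lemma agree_id_Suc:
  assumes "\<sigma> \<in> tree_aut" "agree (Suc n) \<sigma> id"
  shows "Par \<sigma> [] = 0" "agree n (sec \<sigma> [s]) id"
proof -
  show "Par \<sigma> [] = 0" using assms by (auto simp: Par_def agree_def)
  show "agree n (sec \<sigma> [s]) id"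
    using assms(2) by (auto simp: agree_def sec_def)
qed

text \<open>\<open>R\<close> reads \<open>Q\<close> one level down, and \<open>Q\<close> reads
  \<open>R\<close> one level down with a factor 2: two levels per power of two. The bound for
  \<open>Q\<close> is odd because its lowest bit is the parity at the root, visible on level
  1.\<close>

lemma agree_id_QR:
  assumes "\<sigma> \<in> tree_aut"
  shows "(agree (2 * j + 1) \<sigma> id \<longrightarrow> 2 ^ Suc j dvd Q \<sigma> []) \<and> (agree (2 * j) \<sigma> id \<longrightarrow> 2 ^ j dvd R \<sigma>)"
  using assms
proof (induction j arbitrary: \<sigma>)
  case 0
  then show ?case using agree_id_Suc(1)[of \<sigma> 0] by (simp add: Q_root del: id_apply)
next
  case (Suc j)
  have Rs: "2 ^ Suc j dvd R \<sigma>" if \<sigma>: "\<sigma> \<in> tree_aut" and *: "agree (2 * Suc j) \<sigma> id" for \<sigma>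
  proof -
    have "agree (2 * j + 1) (sec \<sigma> [s]) id" for s
      using agree_id_Suc(2)[of \<sigma> "2 * j + 1"] \<sigma> * by simp
    then have "2 ^ Suc j dvd Q (sec \<sigma> [s]) []" for s
      using Suc.IH[of "sec \<sigma> [s]"] \<sigma> by (simp del: id_apply)
    then show ?thesis unfolding R_eq[OF \<sigma>] by (intro dvd_add)
  qed
  moreover have "2 ^ Suc (Suc j) dvd Q \<sigma> []" if *: "agree (2 * Suc j + 1) \<sigma> id"
  proof -
    have "agree (2 * Suc j) (sec \<sigma> [a]) id" "Par \<sigma> [] = 0"
      using agree_id_Suc[of \<sigma> "2 * Suc j"] Suc.prems * by simp_all
    then show ?thesis
      using Rs[of "sec \<sigma> [a]"] Suc.prems by (simp only: Q_root zadic2_cancel_2 of_nat_0 add_0 sec_tree_aut)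
  qed
  ultimately show ?case using Suc.prems by blast
qed

lemma agree_id_P:
  assumes "\<sigma> \<in> tree_aut" "agree (2 * j + 1) \<sigma> id"
  shows "2 ^ Suc j dvd P \<sigma> [] - 1"
proof -
  have "2 ^ j dvd R (sec \<sigma> [s])" for s
    using agree_id_QR[of "sec \<sigma> [s]" j] agree_id_Suc(2)[of \<sigma> "2 * j" s] assms by simp
  then have "2 ^ Suc j dvd 2 * (R (sec \<sigma> [b]) - R (sec \<sigma> [a]))"
    by (simp only: zadic2_cancel_2) (rule dvd_diff)
  then show ?thesis
    using agree_id_Suc(1)[of \<sigma> "2 * j"] assms by (simp add: P_root algebra_simps)
qed

text \<open>The same rate of two levels per power of two: \<open>gen_a ^^ (2 * k)\<close> has both
  sections equal to \<open>gen_b ^^ k\<close>, and \<open>gen_b ^^ k\<close> has sections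
  \<open>gen_a ^^ k\<close> and \<open>id\<close>.\<close>

lemma agree_gen_pow:
  "agree (2 * j) (gen_a ^^ (2 ^ j)) id \<and> agree (2 * j + 1) (gen_b ^^ (2 ^ j)) id"
proof (induction j)
  case 0
  have "agree 0 gen_a id" by (simp add: agree_def)
  then have "agree 1 gen_b id"
    using agree_pair[of 0 gen_a id id id] by (simp add: gen_b_pair[symmetric])
  then show ?case using \<open>agree 0 gen_a id\<close> by (simp del: id_apply)
next
  case (Suc j)
  have A: "agree (2 * Suc j) (gen_a ^^ (2 ^ Suc j)) id"
    using Suc agree_pair[of "2 * j + 1" "gen_b ^^ (2 ^ j)" id "gen_b ^^ (2 ^ j)" id]
    by (simp add: gen_a_even_pow del: id_apply)
  moreover have "agree (2 * Suc j + 1) (gen_b ^^ (2 ^ Suc j)) id"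
  proof -
    have "id ^^ k = id" for k by (induction k) (auto simp: id_def)
    then show ?thesis
      using agree_pair[OF A agree_refl, of id] by (subst gen_b_pair) (simp add: pair_pow)
  qed
  ultimately show ?case by blast
qed

section \<open>Level stabilizers as subgroups of \<open>M_inf\<close>\<close>

definition level_stab :: "nat \<Rightarrow> (node \<Rightarrow> node) set" where
  "level_stab n = {\<sigma> \<in> M_set. agree n \<sigma> id}"

lemma subgroup_M_infI:
  assumes "H \<subseteq> M_set" "id \<in> H" "\<And>x. x \<in> H \<Longrightarrow> inv_into UNIV x \<in> H"
    "\<And>x y. x \<in> H \<Longrightarrow> y \<in> H \<Longrightarrow> x \<circ> y \<in> H"
  shows "subgroup H M_inf"
  using assms by (intro M.subgroupI) (auto simp: inv_M_inf subset_iff)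

lemma subgroup_M_infD:
  assumes "subgroup H M_inf"
  shows "H \<subseteq> M_set" "id \<in> H" "\<And>x. x \<in> H \<Longrightarrow> inv_into UNIV x \<in> H"
    "\<And>x y. x \<in> H \<Longrightarrow> y \<in> H \<Longrightarrow> x \<circ> y \<in> H"
proof -
  show H: "H \<subseteq> M_set" using subgroup.subset[OF assms] by (simp add: carrier_M_inf)
  show "id \<in> H" using subgroup.one_closed[OF assms] by simp
  show "inv_into UNIV x \<in> H" if "x \<in> H" for x
    using subgroup.m_inv_closed[OF assms that] H that by (auto simp: inv_M_inf)
  show "x \<circ> y \<in> H" if "x \<in> H" "y \<in> H" for x y
    using subgroup.m_closed[OF assms that] by simp
qed

lemma agree_inv:
  assumes "\<sigma> \<in> tree_aut" "agree n \<sigma> id"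
  shows "agree n (inv_into UNIV \<sigma>) id"
  using agree_comp[OF agree_refl assms(2,1), of "inv_into UNIV \<sigma>"] assms(1)
  by (simp add: agree_sym)

lemma subgroup_level_stab: "subgroup (level_stab n) M_inf"
proof (rule subgroup_M_infI)
  show "x \<circ> y \<in> level_stab n" if "x \<in> level_stab n" "y \<in> level_stab n" for x y
    using that agree_comp[of n x id y id] by (simp add: level_stab_def M_set_tree_aut)
qed (auto simp: level_stab_def agree_inv M_set_tree_aut)

section \<open>Topological generation of the kernel of P\<close>

definition G_ab :: "(node \<Rightarrow> node) set" where
  "G_ab = generate M_inf {gen_a, gen_b}"

lemma subgroup_G_ab: "subgroup G_ab M_inf"
  unfolding G_ab_def by (rule M.generate_is_subgroup) simp

lemmas G_ab_sub = subgroup_M_infD[OF subgroup_G_ab]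

lemma gen_in_G_ab [simp]: "gen_a \<in> G_ab" "gen_b \<in> G_ab"
  unfolding G_ab_def by (auto intro: generate.incl)

lemma pow_in_subgroup:
  assumes "subgroup H M_inf" "x \<in> H"
  shows "x ^^ k \<in> H"
  using subgroup_M_infD[OF assms(1)] assms(2) by (induction k) (auto simp: id_def[symmetric])

lemma G_ab_induct [consumes 1, case_names id gen_a gen_b inv comp]:
  assumes w: "w \<in> G_ab" and 1: "S id" "S gen_a" "S gen_b"
    and 2: "\<And>x. x \<in> G_ab \<Longrightarrow> S x \<Longrightarrow> S (inv_into UNIV x)"
    and 3: "\<And>x y. x \<in> G_ab \<Longrightarrow> S x \<Longrightarrow> y \<in> G_ab \<Longrightarrow> S y \<Longrightarrow> S (x \<circ> y)"
  shows "S w"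
  using w unfolding G_ab_def
proof (induction rule: generate.induct)
  case (inv h)
  then have "h \<in> G_ab" "S h" "h \<in> M_set" using 1 by auto
  then show ?case using 2 by (simp add: inv_M_inf)
next
  case (eng h1 h2)
  then show ?case using 3 unfolding G_ab_def by (simp del: o_apply)
qed (use 1 in \<open>auto simp del: id_apply\<close>)

lemma P_inv:
  assumes "\<sigma> \<in> M_set" "P \<sigma> [] = 1"
  shows "P (inv_into UNIV \<sigma>) [] = 1" "Q (inv_into UNIV \<sigma>) [] = - Q \<sigma> []"
    "R (inv_into UNIV \<sigma>) = - R \<sigma>"
  using P_comp_root[OF assms(1), of "inv_into UNIV \<sigma>"] Q_comp[OF assms(1), of "inv_into UNIV \<sigma>"]
    R_comp[OF assms(1), of "inv_into UNIV \<sigma>"] assms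
  by (simp_all add: M_set_tree_aut eq_neg_iff_add_eq_0 add.commute)

lemma P_G_ab:
  assumes "w \<in> G_ab"
  shows "P w [] = 1"
  using assms
proof (induction rule: G_ab_induct)
  case (inv x)
  then show ?case using P_inv(1) G_ab_sub(1) by blast
next
  case (comp x y)
  then have "x \<in> M_set" "y \<in> tree_aut" using G_ab_sub(1) M_set_tree_aut by blast+
  then show ?case using comp by (simp add: P_comp_root del: o_apply)
qed (simp_all del: id_apply)

lemma pair_inv_comp:
  assumes "u \<in> M_set" "v \<in> M_set"
  shows "inv_into UNIV (pair u v) = pair (inv_into UNIV u) (inv_into UNIV v)"
  by (rule inv_unique_comp) (simp_all add: pair_comp assms M_set_tree_aut)

lemma pair_id_gen_a: "pair id gen_a \<in> G_ab"
proof -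
  have "pair id gen_a = gen_a \<circ> gen_b \<circ> inv_into UNIV gen_a"
    by (simp add: gen_a_conj comp_assoc)
  then show ?thesis using G_ab_sub by simp
qed

text \<open>Self-replication of the group, checked on generators: \<open>gen_b\<close> is
  \<open>pair gen_a id\<close>, its conjugate by \<open>gen_a\<close> is
  \<open>pair id gen_a\<close>, and the square of \<open>gen_a\<close> is
  \<open>pair gen_b gen_b\<close>. It lets conjugation by any element of \<open>G_ab\<close> be
  realized inside a chosen coordinate.\<close>

lemma G_ab_coords:
  assumes "u \<in> G_ab"
  shows "(\<exists>v\<in>G_ab. pair u v \<in> G_ab) \<and> (\<exists>v\<in>G_ab. pair v u \<in> G_ab)"
  using assms
proof (induction rule: G_ab_induct)
  case id
  then show ?case by (intro conjI bexI[of _ id]) (simp_all add: G_ab_sub del: id_apply)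
next
  case gen_a
  then show ?case
    by (intro conjI bexI[of _ id]) (simp_all add: G_ab_sub pair_id_gen_a gen_b_pair[symmetric] del: id_apply)
next
  case gen_b
  have "pair gen_b gen_b \<in> G_ab" using G_ab_sub(4)[of gen_a gen_a] by (simp add: gen_a_sq)
  then show ?case by (intro conjI bexI[of _ gen_b]) simp_all
next
  case (inv x)
  then obtain v v' where v: "v \<in> G_ab" "pair x v \<in> G_ab" "v' \<in> G_ab" "pair v' x \<in> G_ab" by blast
  have M: "x \<in> M_set" "v \<in> M_set" "v' \<in> M_set" using v inv G_ab_sub(1) by auto
  show ?case using v G_ab_sub(3) pair_inv_comp M by metis
next
  case (comp x y)
  then show ?case using G_ab_sub(4) pair_comp by metis
qed

text \<open>Contains the normal closure of \<open>gen_a\<close> in \<open>G_ab\<close>; together with the powers of \<open>gen_b\<close> it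
  makes up \<open>G_ab\<close>, and both its coordinate embeddings stay in \<open>G_ab\<close>. This is what reduces
  the approximation of an automorphism to the approximation of its sections.\<close>

definition D_ab :: "(node \<Rightarrow> node) set" where
  "D_ab = {k \<in> G_ab. pair k id \<in> G_ab \<and> pair id k \<in> G_ab}"

lemma gen_a_D_ab: "gen_a \<in> D_ab"
  by (simp add: D_ab_def pair_id_gen_a gen_b_pair[symmetric])

lemma D_ab_comp:
  assumes "k \<in> D_ab" "l \<in> D_ab"
  shows "k \<circ> l \<in> D_ab"
proof -
  have "pair (k \<circ> l) id = pair k id \<circ> pair l id" "pair id (k \<circ> l) = pair id k \<circ> pair id l"
    by (simp_all add: pair_comp)
  then show ?thesis using assms by (simp add: D_ab_def G_ab_sub)
qed

lemma D_ab_inv: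
  assumes "k \<in> D_ab"
  shows "inv_into UNIV k \<in> D_ab"
proof -
  have k: "k \<in> M_set" using assms G_ab_sub(1) by (auto simp: D_ab_def)
  have "inv_into UNIV id = (id :: node \<Rightarrow> node)" by simp
  then show ?thesis using assms G_ab_sub(3)[of "pair k id"] G_ab_sub(3)[of "pair id k"]
    by (simp add: D_ab_def G_ab_sub pair_inv_comp k)
qed

lemma D_ab_conj:
  assumes "k \<in> D_ab" "u \<in> G_ab"
  shows "u \<circ> k \<circ> inv_into UNIV u \<in> D_ab"
proof -
  obtain v v' where v: "v \<in> G_ab" "pair u v \<in> G_ab" "v' \<in> G_ab" "pair v' u \<in> G_ab"
    using G_ab_coords[OF assms(2)] by blast
  have M: "u \<in> M_set" "v \<in> M_set" "v' \<in> M_set" using v assms(2) G_ab_sub(1) by auto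
  let ?i = "inv_into UNIV"
  \<comment> \<open>The uncontrolled coordinate \<open>v\<close> or \<open>v'\<close> meets only
    \<open>id\<close> and cancels.\<close>
  have "pair (u \<circ> k \<circ> ?i u) id = pair u v \<circ> pair k id \<circ> ?i (pair u v)"
    "pair id (u \<circ> k \<circ> ?i u) = pair v' u \<circ> pair id k \<circ> ?i (pair v' u)"
    using M by (simp_all add: pair_inv_comp pair_comp M_set_tree_aut)
  then show ?thesis using assms v by (simp add: D_ab_def G_ab_sub)
qed

text \<open>As an element of \<open>G_ab\<close>, \<open>pair d id\<close> has \<open>P\<close>
  equal to 1, while the formula for \<open>P\<close> at the root gives
  \<open>1 - 2 * R d\<close>.\<close>

lemma R_D_ab:
  assumes "d \<in> D_ab"
  shows "R d = 0"
proof (rule zadic2_eq_0I)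
  fix n
  have d: "pair d id \<in> G_ab" using assms by (simp add: D_ab_def)
  then have t: "pair d id \<in> tree_aut" using G_ab_sub(1) M_set_tree_aut by blast
  have "Par (pair d id) [] = 0"
    using assms G_ab_sub(1) M_set_tree_aut[of d] tree_autD(2)[of d] by (auto simp: Par_def D_ab_def)
  then have "2 * R d = 0" using P_G_ab[OF d] P_root[OF t] by simp
  then show "2 ^ n dvd R d" using zadic2_cancel_2[of n "R d"] by simp
qed

lemma gen_b_nat_pow: "gen_b [^]\<^bsub>M_inf\<^esub> (k :: nat) = gen_b ^^ k"
  by (induction k) (simp_all add: id_def[symmetric] funpow_Suc_right del: funpow.simps(2))

lemma gen_b_int_pow:
  fixes j :: int
  shows "gen_b [^]\<^bsub>M_inf\<^esub> j \<in> G_ab" "R (gen_b [^]\<^bsub>M_inf\<^esub> j) = of_int j"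
    "2 ^ i dvd j \<Longrightarrow> agree (2 * i + 1) (gen_b [^]\<^bsub>M_inf\<^esub> j) id"
proof -
  have sub: "gen_b [^]\<^bsub>M_inf\<^esub> j \<in> H" if "subgroup H M_inf" "gen_b \<in> H" for j :: int and H
    using M.subgroup_int_pow_closed[OF that] .
  show "gen_b [^]\<^bsub>M_inf\<^esub> j \<in> G_ab" using sub[OF subgroup_G_ab] by simp
  show "R (gen_b [^]\<^bsub>M_inf\<^esub> j) = of_int j"
  proof (cases j rule: int_cases2)
    case (nonneg n)
    then show ?thesis by (simp add: int_pow_int gen_b_nat_pow)
  next
    case (nonpos n)
    then show ?thesis
      by (simp add: M.int_pow_neg int_pow_int gen_b_nat_pow inv_M_inf P_inv)
  qed
  assume "2 ^ i dvd j"
  then obtain t where t: "j = 2 ^ i * t" by (elim dvdE)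
  have "gen_b [^]\<^bsub>M_inf\<^esub> j = (gen_b [^]\<^bsub>M_inf\<^esub> (int (2 ^ i))) [^]\<^bsub>M_inf\<^esub> t"
    unfolding t by (subst M.int_pow_pow) simp_all
  also have "gen_b [^]\<^bsub>M_inf\<^esub> (int (2 ^ i)) = gen_b ^^ (2 ^ i)"
    by (simp only: int_pow_int gen_b_nat_pow)
  also have "(gen_b ^^ (2 ^ i)) [^]\<^bsub>M_inf\<^esub> t \<in> level_stab (2 * i + 1)"
    using agree_gen_pow[of i]
    by (intro M.subgroup_int_pow_closed subgroup_level_stab) (simp add: level_stab_def)
  finally show "agree (2 * i + 1) (gen_b [^]\<^bsub>M_inf\<^esub> j) id" by (simp add: level_stab_def)
qed

text \<open>\<open>D_ab\<close> is normal in \<open>G_ab\<close> and contains \<open>gen_a\<close>,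
  so the quotient is cyclic, generated by the image of \<open>gen_b\<close>.\<close>

lemma G_ab_decomp:
  assumes "w \<in> G_ab"
  shows "\<exists>d\<in>D_ab. \<exists>j :: int. w = d \<circ> gen_b [^]\<^bsub>M_inf\<^esub> j"
  using assms
proof (induction rule: G_ab_induct)
  case id
  have "id \<in> D_ab" by (simp add: D_ab_def G_ab_sub)
  then show ?case by (intro bexI[of _ id] exI[of _ "0 :: int"]) simp_all
next
  case gen_a
  show ?case by (intro bexI[OF _ gen_a_D_ab] exI[of _ "0 :: int"]) simp
next
  case gen_b
  have "id \<in> D_ab" by (simp add: D_ab_def G_ab_sub)
  then show ?case by (intro bexI[of _ id] exI[of _ "1 :: int"]) simp_all
next
  case (inv x)
  then obtain d and j :: int where d: "d \<in> D_ab" "x = d \<circ> gen_b [^]\<^bsub>M_inf\<^esub> j" by blast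
  define c where "c = gen_b [^]\<^bsub>M_inf\<^esub> (- j)"
  have c: "c \<in> G_ab" unfolding c_def by (rule gen_b_int_pow)
  have M: "d \<in> M_set" "c \<in> M_set" using d c G_ab_sub(1) by (auto simp: D_ab_def)
  have "inv_into UNIV x = c \<circ> inv_into UNIV d"
  proof (rule inv_unique_comp)
    have cc: "c \<circ> gen_b [^]\<^bsub>M_inf\<^esub> j = id" "gen_b [^]\<^bsub>M_inf\<^esub> j \<circ> c = id"
      unfolding c_def using M.int_pow_mult[of gen_b "- j" j] M.int_pow_mult[of gen_b j "- j"] by simp_all
    show "x \<circ> (c \<circ> inv_into UNIV d) = id"
      using cc(2) M M_set_tree_aut unfolding d
      by (metis comp_assoc comp_id id_comp tree_aut_inv_comp(2))
    show "(c \<circ> inv_into UNIV d) \<circ> x = id"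
      using cc(1) M M_set_tree_aut unfolding d
      by (metis comp_assoc comp_id id_comp tree_aut_inv_comp(1))
  qed
  also have "\<dots> = (c \<circ> inv_into UNIV d \<circ> inv_into UNIV c) \<circ> c"
    using M by (simp add: comp_assoc M_set_tree_aut)
  finally show ?case using D_ab_conj[OF D_ab_inv[OF d(1)] c] unfolding c_def by blast
next
  case (comp x y)
  then obtain d d' and j j' :: int where d: "d \<in> D_ab" "x = d \<circ> gen_b [^]\<^bsub>M_inf\<^esub> j"
    "d' \<in> D_ab" "y = d' \<circ> gen_b [^]\<^bsub>M_inf\<^esub> j'" by blast
  define c where "c = gen_b [^]\<^bsub>M_inf\<^esub> j"
  have c: "c \<in> G_ab" unfolding c_def by (rule gen_b_int_pow)
  then have "c \<in> tree_aut" using G_ab_sub(1) M_set_tree_aut by blast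
  then have "x \<circ> y = d \<circ> (c \<circ> d' \<circ> inv_into UNIV c) \<circ> (c \<circ> gen_b [^]\<^bsub>M_inf\<^esub> j')"
    unfolding d c_def[symmetric] by (metis comp_assoc comp_id tree_aut_inv_comp(1))
  moreover have "c \<circ> gen_b [^]\<^bsub>M_inf\<^esub> j' = gen_b [^]\<^bsub>M_inf\<^esub> (j + j')"
    unfolding c_def using M.int_pow_mult[of gen_b j j'] by simp
  ultimately show ?case
    using D_ab_comp[OF d(1) D_ab_conj[OF d(3) c]] by metis
qed

text \<open>If \<open>P\<close> is close to 1 and the root is inactive, both sections have nearly
  the same \<open>R\<close>, say \<open>k\<close>. Then \<open>pair c c\<close> with
  \<open>c = gen_b ^^ k\<close>, an even power of \<open>gen_a\<close>, can be split off. The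
  remaining sections have \<open>R\<close> near 0 and are approximated inside \<open>D_ab\<close>,
  whose elements, unlike those of \<open>G_ab\<close>, can be combined freely in the two
  coordinates.\<close>

lemma G_ab_approx:
  assumes "g \<in> M_set" "2 ^ Suc m dvd P g [] - 1"
  shows "\<exists>w\<in>G_ab. agree m w g"
  using assms
proof (induction m arbitrary: g)
  case 0
  then show ?case
    by (intro bexI[of _ id]) (auto simp: agree_def G_ab_sub M_set_tree_aut tree_autD(2))
next
  case (Suc m)
  let ?i = "inv_into UNIV"
  have main: "\<exists>w\<in>G_ab. agree (Suc m) w h"
    if h: "h \<in> M_set" and Ph: "2 ^ Suc (Suc m) dvd P h [] - 1" and e: "Par h [] = 0" for h
  proof -
    have ht: "h \<in> tree_aut" using h by (rule M_set_tree_aut)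
    have "P h [] - 1 = 2 * (R (sec h [b]) - R (sec h [a]))"
      using P_root[OF ht] e by (simp add: algebra_simps)
    then have RR: "2 ^ Suc m dvd R (sec h [b]) - R (sec h [a])"
      using Ph by (simp only: zadic2_cancel_2)
    obtain k where ka: "2 ^ Suc m dvd R (sec h [a]) - of_nat k" using zadic2_approx by blast
    then have kb: "2 ^ Suc m dvd R (sec h [b]) - of_nat k"
      using dvd_add[OF RR ka] by simp
    define c where "c = gen_b ^^ k"
    have c: "c \<in> G_ab" "c \<in> M_set" "c \<in> tree_aut" unfolding c_def
      using pow_in_subgroup[OF subgroup_G_ab] M_set_tree_aut by auto
    \<comment> \<open>The induction hypothesis only provides a word
      \<open>d \<circ> gen_b [^] j\<close>. Its exponent \<open>j\<close> is recovered as its value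
      of \<open>R\<close>, hence highly divisible by 2, so that the power of \<open>gen_b\<close> is
      invisible up to level \<open>m\<close>.\<close>
    have key: "\<exists>d\<in>D_ab. agree m d (?i c \<circ> x)"
      if x: "x \<in> M_set" "2 ^ Suc m dvd P x [] - 1" "2 ^ Suc m dvd R x - of_nat k" for x
    proof -
      define y where "y = ?i c \<circ> x"
      have y: "y \<in> M_set" unfolding y_def using c x by simp
      have xt: "x \<in> tree_aut" using x(1) by (rule M_set_tree_aut)
      have ci: "P (?i c) [] = 1" "R (?i c) = - of_nat k"
        using P_inv[of c] by (simp_all add: c_def)
      have Py: "P y [] = P x []" and Ry: "R y = R x - of_nat k"
        unfolding y_def using c xt ci by (simp_all add: P_comp_root R_comp)
      then obtain w where w: "w \<in> G_ab" "agree m w y"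
        using Suc.IH[OF y] x(2) by metis
      obtain d and j :: int where d: "d \<in> D_ab" "w = d \<circ> gen_b [^]\<^bsub>M_inf\<^esub> j"
        using G_ab_decomp[OF w(1)] by blast
      have dG: "d \<in> G_ab" using d by (simp add: D_ab_def)
      have M: "w \<in> M_set" "d \<in> M_set" "gen_b [^]\<^bsub>M_inf\<^esub> j \<in> M_set"
        using w dG gen_b_int_pow(1) G_ab_sub(1) by auto
      note t = M[THEN M_set_tree_aut] M_set_tree_aut[OF y]
      define z where "z = ?i w \<circ> y"
      have z: "z \<in> tree_aut" unfolding z_def using t by simp
      have "agree m z id"
        using agree_comp[OF agree_refl w(2) t(1), of "?i w"] t by (simp add: z_def agree_sym)
      \<comment> \<open>Rounding \<open>m\<close> down to an even level costs at most one level,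
        which the odd bound \<open>2 * i + 1\<close> in \<open>gen_b_int_pow\<close> gives
        back.\<close>
      then have "agree (2 * (m div 2)) z id" by (rule agree_mono) simp
      then have Rz: "2 ^ (m div 2) dvd R z" using agree_id_QR[OF z] by blast
      have "y = w \<circ> z" unfolding z_def using t by (simp add: comp_assoc[symmetric])
      then have "R y = R w + R z" using R_comp[OF M(1) z] P_G_ab[OF w(1)] by simp
      moreover have "R w = of_int j"
        unfolding d using R_comp[OF M(2) t(3)] P_G_ab[OF dG] R_D_ab[OF d(1)]
        by (simp add: gen_b_int_pow)
      ultimately have "of_int j = R y - R z" by simp
      moreover have "2 ^ (m div 2) dvd R y"
        unfolding Ry by (rule dvd_trans[OF le_imp_power_dvd x(3)]) simp
      ultimately have "2 ^ (m div 2) dvd (of_int j :: zadic2)" using Rz by simp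
      then have "2 ^ (m div 2) dvd j" by (simp only: power2_dvd_of_int)
      then have "agree (2 * (m div 2) + 1) (gen_b [^]\<^bsub>M_inf\<^esub> j) id" by (rule gen_b_int_pow)
      then have "agree m (gen_b [^]\<^bsub>M_inf\<^esub> j) id" by (rule agree_mono) presburger
      then have "agree m w d"
        unfolding d(2) using agree_comp[OF agree_refl _ t(3), of m id d] by simp
      then show ?thesis using d(1) agree_trans[OF agree_sym w(2)] unfolding y_def by blast
    qed
    have Ps: "2 ^ Suc m dvd P (sec h [s]) [] - 1" for s
      unfolding sec_M_set(2)[OF h] by (rule dvd_trans[OF le_imp_power_dvd Ph]) simp
    obtain da where da: "da \<in> D_ab" "agree m da (?i c \<circ> sec h [a])"
      using key[OF sec_M_set(1)[OF h] Ps ka] by blast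
    obtain db where db: "db \<in> D_ab" "agree m db (?i c \<circ> sec h [b])"
      using key[OF sec_M_set(1)[OF h] Ps kb] by blast
    have "pair da db = pair da id \<circ> pair id db" by (simp add: pair_comp)
    then have dd: "pair da db \<in> G_ab" using da db by (simp add: D_ab_def G_ab_sub)
    have cc: "pair c c \<in> G_ab"
      using pow_in_subgroup[OF subgroup_G_ab gen_in_G_ab(1), of "2 * k"]
      by (simp add: gen_a_even_pow c_def)
    have "agree (Suc m) (pair c c \<circ> pair da db) (pair c c \<circ> pair (?i c \<circ> sec h [a]) (?i c \<circ> sec h [b]))"
      using agree_comp[OF agree_refl agree_pair[OF da(2) db(2)]] dd G_ab_sub(1) M_set_tree_aut by blast
    also have "pair c c \<circ> pair (?i c \<circ> sec h [a]) (?i c \<circ> sec h [b]) = h"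
      using c(3) by (simp add: pair_comp comp_assoc[symmetric] pair_sec[OF ht e, symmetric])
    finally show ?thesis using G_ab_sub(4)[OF cc dd] by blast
  qed
  have gt: "g \<in> tree_aut" using Suc.prems(1) by (rule M_set_tree_aut)
  show ?case
  proof (cases "Par g [] = 0")
    case True
    then show ?thesis using main Suc.prems by blast
  next
    case False
    have "Par (gen_a \<circ> g) [] = 0" using False gt by (simp add: Par_comp_root)
    moreover have "P (gen_a \<circ> g) [] = P g []" using gt by (simp add: P_comp_root)
    ultimately obtain w where w: "w \<in> G_ab" "agree (Suc m) w (gen_a \<circ> g)"
      using main[of "gen_a \<circ> g"] Suc.prems by auto
    have "agree (Suc m) (?i gen_a \<circ> w) (?i gen_a \<circ> (gen_a \<circ> g))"
      using agree_comp[OF agree_refl w(2)] w(1) G_ab_sub(1) M_set_tree_aut by blast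
    also have "?i gen_a \<circ> (gen_a \<circ> g) = g" by (simp add: comp_assoc[symmetric])
    finally have "agree (Suc m) (?i gen_a \<circ> w) g" .
    moreover have "?i gen_a \<circ> w \<in> G_ab" by (intro G_ab_sub(4) G_ab_sub(3) gen_in_G_ab w(1))
    ultimately show ?thesis by (rule bexI)
  qed
qed

section \<open>Open subgroups of M\<close>

lemma tree_aut_cancel:
  assumes "\<sigma> \<in> tree_aut"
  shows "inv_into UNIV \<sigma> \<circ> (\<sigma> \<circ> \<tau>) = \<tau>" "\<sigma> \<circ> (inv_into UNIV \<sigma> \<circ> \<tau>) = \<tau>"
  using assms by (simp_all add: comp_assoc[symmetric])

lemma subtopology_M_set:
  "subtopology aut_topology M_set = subtopology (product_topology (\<lambda>_. discrete_topology UNIV) UNIV) M_set"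
proof -
  have "tree_aut \<inter> M_set = M_set" by (auto simp: M_set_def)
  then show ?thesis by (simp add: aut_topology_def subtopology_subtopology)
qed

lemma topspace_M_set [simp]: "topspace (subtopology aut_topology M_set) = M_set"
  by (simp add: subtopology_M_set)

lemma openin_agree:
  "openin (subtopology aut_topology M_set) {\<tau> \<in> M_set. agree n \<tau> \<sigma>}"
proof -
  define U where "U w = (if length w \<le> n then {\<sigma> w} else UNIV)" for w :: node
  have "{w. U w \<noteq> topspace (discrete_topology UNIV)} \<subseteq> {w. set w \<subseteq> UNIV \<and> length w \<le> n}"
    by (auto simp: U_def)
  then have "finite {w \<in> UNIV. U w \<noteq> topspace (discrete_topology UNIV)}"
    using finite_lists_length_le[of "UNIV :: letter set" n] by (simp add: finite_subset)
  then have "openin (product_topology (\<lambda>_. discrete_topology UNIV) UNIV) (Pi\<^sub>E UNIV U)"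
    by (subst openin_PiE_gen) simp
  moreover have "{\<tau> \<in> M_set. agree n \<tau> \<sigma>} = Pi\<^sub>E UNIV U \<inter> M_set"
    by (auto simp: U_def agree_def PiE_iff split: if_splits)
  ultimately show ?thesis unfolding subtopology_M_set openin_subtopology by blast
qed

lemma openin_M_set_agree:
  assumes "openin (subtopology aut_topology M_set) S" "\<sigma> \<in> S"
  shows "\<exists>n. \<forall>\<tau>\<in>M_set. agree n \<tau> \<sigma> \<longrightarrow> \<tau> \<in> S"
proof -
  obtain T where T: "openin (product_topology (\<lambda>_. discrete_topology UNIV) UNIV) T" "S = T \<inter> M_set"
    using assms(1) unfolding subtopology_M_set openin_subtopology by blast
  then obtain U where U: "finite {w :: node. U w \<noteq> UNIV}" "\<sigma> \<in> Pi\<^sub>E UNIV U" "Pi\<^sub>E UNIV U \<subseteq> T"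
    using assms(2) unfolding openin_product_topology_alt by fastforce
  obtain n where n: "\<And>w. U w \<noteq> UNIV \<Longrightarrow> length w \<le> n"
    using finite_nat_set_iff_bounded_le[of "length ` {w. U w \<noteq> UNIV}"] U(1) by auto
  have "\<tau> \<in> S" if \<tau>: "\<tau> \<in> M_set" "agree n \<tau> \<sigma>" for \<tau>
  proof -
    have "\<tau> w \<in> U w" for w
      using n[of w] \<tau>(2) U(2) by (cases "U w = UNIV") (auto simp: agree_def PiE_iff)
    then show ?thesis using U(3) T(2) \<tau>(1) by auto
  qed
  then show ?thesis by blast
qed

text \<open>The complement is a union of cosets of \<open>level_stab n\<close>, each of them
  open.\<close>

lemma open_subgroup_closed:
  assumes K: "subgroup K M_inf" and n: "level_stab n \<subseteq> K"
  shows "closed_subgroup K aut_topology M_inf"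
proof -
  note Ks = subgroup_M_infD[OF K]
  have "openin (subtopology aut_topology M_set) (M_set - K)"
  proof (subst openin_subopen, intro ballI)
    fix \<sigma> assume \<sigma>: "\<sigma> \<in> M_set - K"
    have "\<tau> \<notin> K" if \<tau>: "\<tau> \<in> M_set" "agree n \<tau> \<sigma>" for \<tau>
    proof
      assume "\<tau> \<in> K"
      have \<tau>t: "\<tau> \<in> tree_aut" "\<sigma> \<in> tree_aut" using \<tau> \<sigma> M_set_tree_aut by auto
      have "agree n (inv_into UNIV \<tau> \<circ> \<sigma>) (inv_into UNIV \<tau> \<circ> \<tau>)"
        using agree_comp[OF agree_refl agree_sym[OF \<tau>(2)] \<tau>t(2)] .
      then have "inv_into UNIV \<tau> \<circ> \<sigma> \<in> K"
        using n \<tau> \<sigma> \<tau>t by (auto simp: level_stab_def)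
      then have "\<tau> \<circ> (inv_into UNIV \<tau> \<circ> \<sigma>) \<in> K" using Ks(4) \<open>\<tau> \<in> K\<close> by blast
      then show False using \<sigma> \<tau>t by (simp add: tree_aut_cancel)
    qed
    then show "\<exists>T. openin (subtopology aut_topology M_set) T \<and> \<sigma> \<in> T \<and> T \<subseteq> M_set - K"
      using openin_agree[of n \<sigma>] \<sigma> by (intro exI[of _ "{\<tau> \<in> M_set. agree n \<tau> \<sigma>}"]) auto
  qed
  then show ?thesis
    using K Ks(1) by (simp add: closed_subgroup_def closedin_def carrier_M_inf del: topspace_subtopology)
qed

lemma maximal_closedD:
  assumes "maximal_closed_subgroup H aut_topology M_inf"
  shows "subgroup H M_inf" "H \<noteq> M_set"
    "\<And>K n. subgroup K M_inf \<Longrightarrow> level_stab n \<subseteq> K \<Longrightarrow> H \<subseteq> K \<Longrightarrow> K = H \<or> K = M_set"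
  using assms open_subgroup_closed
  by (auto simp: maximal_closed_subgroup_def closed_subgroup_def carrier_M_inf)

text \<open>A proper closed subgroup misses a whole neighbourhood of some \<sigma>. Thickening
  \<open>H\<close> by the corresponding level stabilizer gives an open subgroup that still misses
  \<sigma>, so by maximality it is \<open>H\<close> itself.\<close>

lemma maximal_level_stab:
  assumes "maximal_closed_subgroup H aut_topology M_inf"
  shows "\<exists>n. level_stab n \<subseteq> H"
proof -
  note H = maximal_closedD[OF assms]
  note Hs = subgroup_M_infD[OF H(1)]
  obtain \<sigma> where \<sigma>: "\<sigma> \<in> M_set - H" using H(2) Hs(1) by blast
  have "openin (subtopology aut_topology M_set) (M_set - H)"
    using assms by (simp add: maximal_closed_subgroup_def closed_subgroup_def carrier_M_inf closedin_def del: topspace_subtopology)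
  then obtain n where n: "\<And>\<tau>. \<tau> \<in> M_set \<Longrightarrow> agree n \<tau> \<sigma> \<Longrightarrow> \<tau> \<notin> H"
    using openin_M_set_agree[OF _ \<sigma>] by blast
  define K where "K = {\<tau> \<in> M_set. \<exists>h\<in>H. agree n h \<tau>}"
  have "subgroup K M_inf"
  proof (rule subgroup_M_infI)
    show "id \<in> K" using Hs(2) by (auto simp: K_def intro: bexI[of _ id])
    show "inv_into UNIV x \<in> K" if x: "x \<in> K" for x
    proof -
      obtain h where h: "h \<in> H" "agree n h x" "x \<in> M_set" using x by (auto simp: K_def)
      have t: "h \<in> tree_aut" "x \<in> tree_aut" "inv_into UNIV x \<in> tree_aut"
        using h Hs(1) M_set_tree_aut by auto
      have "agree n (inv_into UNIV h \<circ> (x \<circ> inv_into UNIV x)) (inv_into UNIV h \<circ> (h \<circ> inv_into UNIV x))"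
        using agree_comp[OF agree_refl agree_comp[OF agree_sym[OF h(2)] agree_refl t(3)]] t by simp
      then have "agree n (inv_into UNIV h) (inv_into UNIV x)"
        using t by (simp add: tree_aut_cancel)
      then show ?thesis using h Hs(3) by (auto simp: K_def)
    qed
    show "x \<circ> y \<in> K" if xy: "x \<in> K" "y \<in> K" for x y
    proof -
      obtain h h' where h: "h \<in> H" "agree n h x" "x \<in> M_set" "h' \<in> H" "agree n h' y" "y \<in> M_set"
        using xy by (auto simp: K_def)
      then have "agree n (h \<circ> h') (x \<circ> y)"
        using agree_comp Hs(1) M_set_tree_aut by blast
      then show ?thesis using h Hs(4) by (auto simp: K_def)
    qed
  qed (auto simp: K_def)
  moreover have "level_stab n \<subseteq> K"
    using Hs(2) by (auto simp: K_def level_stab_def intro!: bexI[of _ id] agree_sym)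
  moreover have "H \<subseteq> K" using Hs(1) by (auto simp: K_def intro: agree_refl)
  moreover have "\<sigma> \<notin> K" using n Hs(1) by (auto simp: K_def)
  ultimately show ?thesis using H(3) \<sigma> by blast
qed

section \<open>A central filtration of the level stabilizers\<close>

text \<open>The Kaloujnine filtration: \<open>lowdeg n i\<close> holds for the functions on the words of length \<open>n\<close> that
  are sums of the first \<open>i\<close> square-free monomials in the letters, ordered lexicographically with
  the last letter the most significant. Tree automorphisms act unitriangularly with respect to
  this ordering.\<close>

fun lowdeg :: "nat \<Rightarrow> nat \<Rightarrow> (node \<Rightarrow> bool) \<Rightarrow> bool" where
  "lowdeg 0 i f \<longleftrightarrow> i > 0 \<or> \<not> f []"
| "lowdeg (Suc n) i f \<longleftrightarrow>
     lowdeg n (i - 2 ^ n) (\<lambda>w. f (w @ [a]) \<noteq> f (w @ [b])) \<and> lowdeg n i (\<lambda>w. f (w @ [a]))"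

lemma lowdeg_cong:
  "(\<And>w. length w = n \<Longrightarrow> f w = g w) \<Longrightarrow> lowdeg n i f = lowdeg n i g"
proof (induction n arbitrary: i f g)
  case (Suc n)
  have "f (w @ [c]) = g (w @ [c])" if "length w = n" for w c
    using Suc.prems[of "w @ [c]"] that by simp
  then have "lowdeg n (i - 2 ^ n) (\<lambda>w. f (w @ [a]) \<noteq> f (w @ [b])) =
      lowdeg n (i - 2 ^ n) (\<lambda>w. g (w @ [a]) \<noteq> g (w @ [b]))"
    "lowdeg n i (\<lambda>w. f (w @ [a])) = lowdeg n i (\<lambda>w. g (w @ [a]))"
    by (intro Suc.IH; simp)+
  then show ?case by simp
qed simp

lemma lowdeg_full: "2 ^ n \<le> i \<Longrightarrow> lowdeg n i f"
  by (induction n arbitrary: i f) auto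

lemma lowdeg_zero: "lowdeg n 0 f \<longleftrightarrow> (\<forall>w. length w = n \<longrightarrow> \<not> f w)"
proof (induction n arbitrary: f)
  case (Suc n)
  have "(\<forall>w. length w = Suc n \<longrightarrow> \<not> f w) \<longleftrightarrow> (\<forall>w. length w = n \<longrightarrow> \<not> f (w @ [a]) \<and> \<not> f (w @ [b]))"
  proof
    assume A: "\<forall>w. length w = n \<longrightarrow> \<not> f (w @ [a]) \<and> \<not> f (w @ [b])"
    show "\<forall>w. length w = Suc n \<longrightarrow> \<not> f w"
    proof (intro allI impI)
      fix w :: node assume "length w = Suc n"
      then obtain v c where "w = v @ [c]" "length v = n" by (cases w rule: rev_cases) auto
      then show "\<not> f w" using A by (cases c) auto
    qed
  qed simp
  then show ?case using Suc by auto
qed simp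

lemma lowdeg_xor:
  "lowdeg n i f \<Longrightarrow> lowdeg n i g \<Longrightarrow> lowdeg n i (\<lambda>w. f w \<noteq> g w)"
proof (induction n arbitrary: i f g)
  case (Suc n)
  have "(\<lambda>w. (f (w @ [a]) \<noteq> g (w @ [a])) \<noteq> (f (w @ [b]) \<noteq> g (w @ [b]))) =
      (\<lambda>w. (f (w @ [a]) \<noteq> f (w @ [b])) \<noteq> (g (w @ [a]) \<noteq> g (w @ [b])))" by auto
  then show ?case
    using Suc.prems Suc.IH[of "i - 2 ^ n" "\<lambda>w. f (w @ [a]) \<noteq> f (w @ [b])" "\<lambda>w. g (w @ [a]) \<noteq> g (w @ [b])"]
      Suc.IH[of i "\<lambda>w. f (w @ [a])" "\<lambda>w. g (w @ [a])"]
    by (simp only: lowdeg.simps)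
qed auto

text \<open>The difference in the last letter does not notice a swap of that letter, so it is
  transported by \<tau> alone. The value at last letter \<open>a\<close> changes at most by this
  difference, which vanishes for \<open>i < 2 ^ n\<close>; for larger \<open>i\<close> the condition
  on the value is void.\<close>

lemma lowdeg_comp:
  assumes \<tau>: "\<tau> \<in> tree_aut"
  shows "lowdeg n i f \<Longrightarrow> lowdeg n i (\<lambda>w. f (\<tau> w))"
proof (induction n arbitrary: i f)
  case 0
  then show ?case by (simp add: tree_autD(2)[OF \<tau>])
next
  case (Suc n)
  let ?f1 = "\<lambda>w. f (w @ [a]) \<noteq> f (w @ [b])"
  have f1: "(f (\<tau> (w @ [a])) \<noteq> f (\<tau> (w @ [b]))) = ?f1 (\<tau> w)" for w
    by (rule Par_cases[OF \<tau>, of w]) auto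
  have "lowdeg n i (\<lambda>w. f (\<tau> (w @ [a])))"
  proof (cases "2 ^ n \<le> i")
    case False
    \<comment> \<open>Subtraction of naturals truncates: \<open>i - 2 ^ n\<close> is 0 here, so
      \<open>f\<close> is independent of the last letter.\<close>
    then have "lowdeg n 0 ?f1" using Suc.prems by simp
    then have "f (\<tau> (w @ [a])) = f (\<tau> w @ [a])" if "length w = n" for w
      using that \<tau> by - (rule Par_cases[OF \<tau>, of w]; simp add: lowdeg_zero)
    then have "lowdeg n i (\<lambda>w. f (\<tau> (w @ [a]))) = lowdeg n i (\<lambda>w. f (\<tau> w @ [a]))"
      by (rule lowdeg_cong)
    then show ?thesis using Suc.IH[of i "\<lambda>w. f (w @ [a])"] Suc.prems by simp
  qed (rule lowdeg_full)
  then show ?case using Suc.IH[of "i - 2 ^ n" ?f1] Suc.prems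
    by (simp only: lowdeg.simps f1)
qed

text \<open>Unitriangularity. For \<open>2 ^ n \<le> i\<close> the difference in the last letter
  drops by induction, as \<open>Suc i - 2 ^ n = Suc (i - 2 ^ n)\<close>; for
  \<open>i < 2 ^ n\<close> even \<open>Suc i - 2 ^ n\<close> is 0, so that difference is already
  zero.\<close>

lemma lowdeg_comp_diff:
  assumes \<tau>: "\<tau> \<in> tree_aut"
  shows "lowdeg n (Suc i) f \<Longrightarrow> lowdeg n i (\<lambda>w. f w \<noteq> f (\<tau> w))"
proof (induction n arbitrary: i f)
  case 0
  then show ?case by (simp add: tree_autD(2)[OF \<tau>])
next
  case (Suc n)
  let ?f1 = "\<lambda>w. f (w @ [a]) \<noteq> f (w @ [b])"
  have f1: "((f (w @ [a]) \<noteq> f (\<tau> (w @ [a]))) \<noteq> (f (w @ [b]) \<noteq> f (\<tau> (w @ [b])))) = (?f1 w \<noteq> ?f1 (\<tau> w))" for w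
    by (rule Par_cases[OF \<tau>, of w]) auto
  have "lowdeg n (i - 2 ^ n) (\<lambda>w. ?f1 w \<noteq> ?f1 (\<tau> w))"
  proof (cases "2 ^ n \<le> i")
    case True
    then show ?thesis using Suc.prems Suc.IH[of "i - 2 ^ n" ?f1] by (simp add: Suc_diff_le)
  next
    case False
    then have "lowdeg n 0 ?f1" using Suc.prems by simp
    then show ?thesis using False \<tau> by (simp add: lowdeg_zero)
  qed
  moreover have "lowdeg n i (\<lambda>w. f (w @ [a]) \<noteq> f (\<tau> (w @ [a])))"
  proof (cases "2 ^ n \<le> i")
    case False
    then have "lowdeg n 0 ?f1" using Suc.prems by simp
    then have "f (\<tau> (w @ [a])) = f (\<tau> w @ [a])" if "length w = n" for w
      using that \<tau> by - (rule Par_cases[OF \<tau>, of w]; simp add: lowdeg_zero)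
    then have "lowdeg n i (\<lambda>w. f (w @ [a]) \<noteq> f (\<tau> (w @ [a]))) =
        lowdeg n i (\<lambda>w. f (w @ [a]) \<noteq> f (\<tau> w @ [a]))"
      by (intro lowdeg_cong) simp
    then show ?thesis using Suc.IH[of i "\<lambda>w. f (w @ [a])"] Suc.prems by simp
  qed (rule lowdeg_full)
  ultimately show ?case unfolding lowdeg.simps f1 by blast
qed

section \<open>Parity functions and the filtration inside \<open>M_set\<close>\<close>

lemma Par_comp:
  assumes "\<sigma> \<in> tree_aut" "\<tau> \<in> tree_aut"
  shows "Par (\<sigma> \<circ> \<tau>) w = 1 \<longleftrightarrow> (Par \<sigma> (\<tau> w) = 1) \<noteq> (Par \<tau> w = 1)"
  by (rule Par_cases[OF assms(1), of "\<tau> w"]; rule Par_cases[OF assms(2), of w])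
    (auto simp: Par_def)

lemma Par_inv:
  assumes "\<sigma> \<in> tree_aut"
  shows "Par (inv_into UNIV \<sigma>) w = 1 \<longleftrightarrow> Par \<sigma> (inv_into UNIV \<sigma> w) = 1"
  using Par_comp[OF assms tree_aut_inv[OF assms], of w] assms by simp

text \<open>On \<open>level_stab n\<close> the parities at level \<open>n\<close> add under
  composition, which embeds the quotient by \<open>level_stab (Suc n)\<close> into the functions on
  words of length \<open>n\<close> modulo 2. The filtration of functions is pulled back along this
  embedding and interpolates between the two stabilizers.\<close>

definition filt :: "nat \<Rightarrow> nat \<Rightarrow> (node \<Rightarrow> node) set" where
  "filt n i = {u \<in> level_stab n. lowdeg n i (\<lambda>w. Par u w = 1)}"

lemma level_stabD:
  assumes "u \<in> level_stab n"
  shows "u \<in> M_set" "u \<in> tree_aut" "length w \<le> n \<Longrightarrow> u w = w"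
  using assms by (auto simp: level_stab_def agree_def M_set_tree_aut)

lemma filt_zero: "filt n 0 = level_stab (Suc n)"
proof
  show "filt n 0 \<subseteq> level_stab (Suc n)"
  proof
    fix u assume u: "u \<in> filt n 0"
    then have us: "u \<in> level_stab n" by (simp add: filt_def)
    have "u w = w" if w: "length w \<le> Suc n" for w
    proof (cases "length w \<le> n")
      case False
      then obtain v c where v: "w = v @ [c]" "length v = n" using w by (cases w rule: rev_cases) auto
      then have "Par u v \<noteq> 1" using u by (simp add: filt_def lowdeg_zero)
      then show ?thesis
        using v level_stabD(3)[OF us, of v]
        by (cases c) (auto intro: Par_cases[OF level_stabD(2)[OF us], of v])
    qed (rule level_stabD(3)[OF us])
    then show "u \<in> level_stab (Suc n)" using us by (simp add: level_stab_def agree_def)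
  qed
  show "level_stab (Suc n) \<subseteq> filt n 0"
    by (auto simp: filt_def lowdeg_zero level_stab_def agree_def Par_def)
qed

lemma filt_full: "filt n (2 ^ n) = level_stab n"
  by (auto simp: filt_def lowdeg_full)

lemma level_stab_conj:
  assumes u: "u \<in> level_stab n" and g: "g \<in> M_set"
  shows "g \<circ> u \<circ> inv_into UNIV g \<in> level_stab n"
proof -
  have gt: "g \<in> tree_aut" using g by (rule M_set_tree_aut)
  have "agree n (g \<circ> u \<circ> inv_into UNIV g) (g \<circ> id \<circ> inv_into UNIV g)"
    using u gt by (intro agree_comp agree_refl) (auto simp: level_stab_def M_set_tree_aut)
  then show ?thesis using u g gt by (simp add: level_stab_def)
qed

text \<open>Since \<open>u\<close> fixes level \<open>n\<close>, the parities of \<open>g\<close>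
  and of its inverse are taken along the same edge and cancel.\<close>

lemma Par_conj_level_stab:
  assumes u: "u \<in> level_stab n" and g: "g \<in> M_set" and w: "length w = n"
  shows "Par (g \<circ> u \<circ> inv_into UNIV g) w = 1 \<longleftrightarrow> Par u (inv_into UNIV g w) = 1"
proof -
  have t: "g \<in> tree_aut" "u \<in> tree_aut" using g u level_stabD M_set_tree_aut by auto
  have "u (inv_into UNIV g w) = inv_into UNIV g w" using level_stabD(3)[OF u] t w by simp
  then show ?thesis using t Par_inv[OF t(1), of w] by (auto simp: Par_comp simp del: One_nat_def)
qed

lemma filt_subgroup: "subgroup (filt n i) M_inf"
proof (rule subgroup_M_infI)
  note L = subgroup_M_infD[OF subgroup_level_stab[of n]]
  show "filt n i \<subseteq> M_set" using L(1) by (auto simp: filt_def)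
  have "lowdeg n i (\<lambda>w. False)" for n i by (induction n arbitrary: i) simp_all
  then show "id \<in> filt n i" using L(2) by (simp add: filt_def)
  show "inv_into UNIV x \<in> filt n i" if x: "x \<in> filt n i" for x
  proof -
    have xs: "x \<in> level_stab n" using x by (simp add: filt_def)
    have "lowdeg n i (\<lambda>w. Par (inv_into UNIV x) w = 1) = lowdeg n i (\<lambda>w. Par x w = 1)"
      using level_stabD(3)[OF L(3)[OF xs]] level_stabD(2)[OF xs]
      by (intro lowdeg_cong) (simp only: Par_inv order_refl)
    then show ?thesis using x L(3) by (simp add: filt_def)
  qed
  show "x \<circ> y \<in> filt n i" if xy: "x \<in> filt n i" "y \<in> filt n i" for x y
  proof -
    have s: "x \<in> level_stab n" "y \<in> level_stab n" using xy by (simp_all add: filt_def)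
    have "lowdeg n i (\<lambda>w. Par (x \<circ> y) w = 1) = lowdeg n i (\<lambda>w. (Par x w = 1) \<noteq> (Par y w = 1))"
      using level_stabD(3)[OF s(2)] level_stabD(2)[OF s(1)] level_stabD(2)[OF s(2)]
      by (intro lowdeg_cong) (simp only: Par_comp order_refl)
    then show ?thesis using xy L(4) lowdeg_xor by (simp add: filt_def)
  qed
qed

lemma filt_conj:
  assumes u: "u \<in> filt n i" and g: "g \<in> M_set"
  shows "g \<circ> u \<circ> inv_into UNIV g \<in> filt n i"
proof -
  have us: "u \<in> level_stab n" using u by (simp add: filt_def)
  have gi: "inv_into UNIV g \<in> tree_aut" using g by (simp add: M_set_tree_aut)
  have "lowdeg n i (\<lambda>w. Par (g \<circ> u \<circ> inv_into UNIV g) w = 1) = lowdeg n i (\<lambda>w. Par u (inv_into UNIV g w) = 1)"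
    by (intro lowdeg_cong Par_conj_level_stab[OF us g])
  then show ?thesis
    using u lowdeg_comp[OF gi, of n i "\<lambda>w. Par u w = 1"] level_stab_conj[OF us g] by (simp add: filt_def)
qed

text \<open>With \<open>u\<close> in place of its inverse, the commutator condition says at once
  that \<open>u\<close> has square one (take \<open>g = id\<close>) and commutes with
  \<open>g\<close> modulo \<open>filt n i\<close>.\<close>

lemma filt_central:
  assumes u: "u \<in> filt n (Suc i)" and g: "g \<in> M_set"
  shows "u \<circ> (g \<circ> u \<circ> inv_into UNIV g) \<in> filt n i"
proof -
  have us: "u \<in> level_stab n" using u by (simp add: filt_def)
  have gi: "inv_into UNIV g \<in> tree_aut" using g by (simp add: M_set_tree_aut)
  let ?c = "g \<circ> u \<circ> inv_into UNIV g"
  have cs: "?c \<in> level_stab n" by (rule level_stab_conj[OF us g])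
  have "(Par (u \<circ> ?c) w = 1) = ((Par u w = 1) \<noteq> (Par u (inv_into UNIV g w) = 1))" if "length w = n" for w
    using Par_comp[OF level_stabD(2)[OF us] level_stabD(2)[OF cs], of w]
      level_stabD(3)[OF cs, of w] Par_conj_level_stab[OF us g, of w] that by simp
  then have "lowdeg n i (\<lambda>w. Par (u \<circ> ?c) w = 1) = lowdeg n i (\<lambda>w. (Par u w = 1) \<noteq> (Par u (inv_into UNIV g w) = 1))"
    by (rule lowdeg_cong)
  then show ?thesis
    using u lowdeg_comp_diff[OF gi, of n i "\<lambda>w. Par u w = 1"]
      subgroup_M_infD(4)[OF subgroup_level_stab us cs] by (simp add: filt_def)
qed

section \<open>Maximal closed subgroups have index two\<close>

lemma normal_product_subgroup:
  assumes H: "subgroup H M_inf" and U: "subgroup U M_inf"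
    and conj: "\<And>u g. u \<in> U \<Longrightarrow> g \<in> M_set \<Longrightarrow> g \<circ> u \<circ> inv_into UNIV g \<in> U"
  shows "subgroup {u \<circ> h | u h. u \<in> U \<and> h \<in> H} M_inf" (is "subgroup ?K M_inf")
proof (rule subgroup_M_infI)
  note Hs = subgroup_M_infD[OF H] and Us = subgroup_M_infD[OF U]
  show "?K \<subseteq> M_set" using Hs(1) Us(1) by auto
  have "id \<circ> id \<in> ?K" using Hs(2) Us(2) by blast
  then show "id \<in> ?K" by simp
  show "inv_into UNIV x \<in> ?K" if xK: "x \<in> ?K" for x
  proof -
    obtain u h where x: "u \<in> U" "h \<in> H" "x = u \<circ> h" using xK by blast
    have t: "u \<in> M_set" "h \<in> M_set" "u \<in> tree_aut" "h \<in> tree_aut" using x Hs(1) Us(1) M_set_tree_aut by auto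
    let ?i = "inv_into UNIV"
    have "?i x = ?i h \<circ> ?i u"
      unfolding x by (rule o_inv_distrib) (use t tree_autD(1) in auto)
    also have "\<dots> = (?i h \<circ> ?i u \<circ> ?i (?i h)) \<circ> ?i h"
      using t tree_aut_inv_comp(1)[of "?i h"] by (simp add: comp_assoc)
    finally show ?thesis using conj[OF Us(3)[OF x(1)], of "?i h"] t Hs(3)[OF x(2)] by auto
  qed
  show "x \<circ> y \<in> ?K" if xy: "x \<in> ?K" "y \<in> ?K" for x y
  proof -
    obtain u h u' h' where x: "u \<in> U" "h \<in> H" "x = u \<circ> h" "u' \<in> U" "h' \<in> H" "y = u' \<circ> h'"
      using xy by blast
    have t: "h \<in> M_set" "h \<in> tree_aut" using x Hs(1) M_set_tree_aut by auto
    have "x \<circ> y = (u \<circ> (h \<circ> u' \<circ> inv_into UNIV h)) \<circ> (h \<circ> h')"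
      unfolding x using t by (simp add: comp_assoc tree_aut_cancel)
    then show ?thesis using Us(4)[OF x(1) conj[OF x(4) t(1)]] Hs(4)[OF x(2,5)] by blast
  qed
qed

text \<open>Choose consecutive terms of the filtration with \<open>filt n i\<close> inside
  \<open>H\<close> and \<open>filt n (Suc i)\<close> not inside. By maximality the latter and
  \<open>H\<close> together make up the group, so \<open>g = u \<circ> h\<close>, and
  \<open>g \<circ> g\<close> is the element of \<open>filt_central\<close> for \<open>u\<close> and
  \<open>h\<close>, followed by \<open>h \<circ> h\<close>.\<close>

lemma maximal_square:
  assumes max: "maximal_closed_subgroup H aut_topology M_inf" and g: "g \<in> M_set"
  shows "g \<circ> g \<in> H"
proof -
  note H = maximal_closedD[OF max]
  note Hs = subgroup_M_infD[OF H(1)]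
  have step: "\<exists>i<m. S i \<and> \<not> S (Suc i)" if "S 0" "\<not> S m" for S :: "nat \<Rightarrow> bool" and m
    using that by (induction m) (auto simp: less_Suc_eq)
  obtain N where "level_stab N \<subseteq> H" using maximal_level_stab[OF max] by blast
  moreover have "level_stab 0 = M_set"
    by (auto simp: level_stab_def agree_def M_set_tree_aut tree_autD(2))
  ultimately obtain n where n: "\<not> level_stab n \<subseteq> H" "level_stab (Suc n) \<subseteq> H"
    using step[of "\<lambda>n. \<not> level_stab n \<subseteq> H" N] H(2) Hs(1) by auto
  then obtain i where i: "filt n i \<subseteq> H" "\<not> filt n (Suc i) \<subseteq> H"
    using step[of "\<lambda>i. filt n i \<subseteq> H" "2 ^ n"] by (auto simp: filt_zero filt_full)
  define K where "K = {u \<circ> h | u h. u \<in> filt n (Suc i) \<and> h \<in> H}"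
  have "subgroup K M_inf"
    unfolding K_def by (rule normal_product_subgroup[OF H(1) filt_subgroup filt_conj])
  moreover have HK: "H \<subseteq> K"
  proof
    fix h assume "h \<in> H"
    then have "id \<circ> h \<in> K" using subgroup_M_infD(2)[OF filt_subgroup] unfolding K_def by blast
    then show "h \<in> K" by simp
  qed
  moreover have "level_stab (Suc n) \<subseteq> K" using n(2) HK by blast
  moreover have "filt n (Suc i) \<subseteq> K"
  proof
    fix u assume "u \<in> filt n (Suc i)"
    then have "u \<circ> id \<in> K" using Hs(2) unfolding K_def by blast
    then show "u \<in> K" by simp
  qed
  ultimately have "K = M_set" using H(3)[of K "Suc n"] i(2) by blast
  then obtain u h where uh: "u \<in> filt n (Suc i)" "h \<in> H" "g = u \<circ> h" using g unfolding K_def by blast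
  have h: "h \<in> M_set" "h \<in> tree_aut" using uh(2) Hs(1) M_set_tree_aut by auto
  have "g \<circ> g = (u \<circ> (h \<circ> u \<circ> inv_into UNIV h)) \<circ> (h \<circ> h)"
    unfolding uh using h by (simp add: comp_assoc tree_aut_cancel)
  then show ?thesis using filt_central[OF uh(1) h(1)] i(1) Hs(4) uh(2) by auto
qed

lemma maximal_conj:
  assumes max: "maximal_closed_subgroup H aut_topology M_inf" and x: "x \<in> H" and g: "g \<in> M_set"
  shows "g \<circ> x \<circ> inv_into UNIV g \<in> H"
proof -
  note H = maximal_closedD[OF max]
  note Hs = subgroup_M_infD[OF H(1)]
  let ?i = "inv_into UNIV"
  have t: "g \<in> tree_aut" "x \<in> tree_aut" "x \<in> M_set" using g x Hs(1) M_set_tree_aut by auto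
  \<comment> \<open>A subgroup that contains all squares is normal.\<close>
  have "g \<circ> x \<circ> ?i g = ((g \<circ> x) \<circ> (g \<circ> x)) \<circ> (?i x \<circ> (?i g \<circ> ?i g))"
    using t by (simp add: comp_assoc tree_aut_cancel)
  then show ?thesis
    using maximal_square[OF max] Hs(3,4) x g t by simp
qed

text \<open>The quotient by \<open>H\<close> has exponent two, hence is abelian, and
  \<open>H\<close> together with one further coset is an open subgroup, which maximality makes the
  whole group.\<close>

lemma maximal_index_two:
  assumes max: "maximal_closed_subgroup H aut_topology M_inf"
    and x: "x \<in> M_set" and y: "y \<in> M_set"
  shows "x \<circ> y \<in> H \<longleftrightarrow> (x \<in> H \<longleftrightarrow> y \<in> H)"
proof -
  note H = maximal_closedD[OF max]
  note Hs = subgroup_M_infD[OF H(1)]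
  let ?i = "inv_into UNIV"
  have t: "x \<in> tree_aut" "y \<in> tree_aut" using x y M_set_tree_aut by auto
  have cancel: "v \<in> H" if "u \<in> H" "u \<circ> v \<in> H" "v \<in> M_set" for u v
    using Hs(4)[OF Hs(3)[OF that(1)] that(2)] that Hs(1) M_set_tree_aut
    by (auto simp: tree_aut_cancel subset_iff)
  have cancel': "u \<in> H" if "v \<in> H" "u \<circ> v \<in> H" for u v
    using Hs(4)[OF that(2) Hs(3)[OF that(1)]] that Hs(1) M_set_tree_aut
    by (auto simp: comp_assoc subset_iff)
  have "x \<circ> y \<in> H" if nx: "x \<notin> H" and ny: "y \<notin> H"
  proof -
    \<comment> \<open>The union of \<open>H\<close> and the coset of the inverse of
      \<open>y\<close>; once it is everything, \<open>x \<notin> H\<close> leaves only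
      \<open>x \<circ> y \<in> H\<close>.\<close>
    define K where "K = {z \<in> M_set. z \<in> H \<or> z \<circ> y \<in> H}"
    have "subgroup K M_inf"
    proof (rule subgroup_M_infI)
      show "inv_into UNIV z \<in> K" if z: "z \<in> K" for z
      proof -
        have zt: "z \<in> M_set" "z \<in> tree_aut" using z M_set_tree_aut by (auto simp: K_def)
        have "?i z \<circ> y = (?i z \<circ> ?i z) \<circ> (z \<circ> y)"
          using zt by (simp add: comp_assoc tree_aut_cancel)
        then have "?i z \<circ> y \<in> H" if "z \<circ> y \<in> H"
          using Hs(4)[OF maximal_square[OF max, of "?i z"] that] zt by simp
        then show ?thesis using z Hs(3) by (auto simp: K_def)
      qed
      show "z \<circ> w \<in> K" if zw: "z \<in> K" "w \<in> K" for z w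
      proof -
        have zt: "z \<in> M_set" "z \<in> tree_aut" "w \<in> M_set" "w \<in> tree_aut"
          using zw M_set_tree_aut by (auto simp: K_def)
        have c: "?i y \<circ> v \<circ> y \<in> H" if "v \<in> H" for v
        proof -
          have "?i y \<circ> v \<circ> ?i (?i y) \<in> H" using maximal_conj[OF max that, of "?i y"] y by simp
          then show ?thesis using tree_autD(1)[OF t(2)] by (simp add: inv_inv_eq)
        qed
        consider "z \<in> H" "w \<in> H" | "z \<in> H" "w \<circ> y \<in> H" | "z \<circ> y \<in> H" "w \<in> H"
          | "z \<circ> y \<in> H" "w \<circ> y \<in> H" using zw by (auto simp: K_def)
        then show ?thesis
        proof cases
          case 1
          then show ?thesis using Hs(4) zt by (simp add: K_def)
        next
          case 2
          then have "z \<circ> (w \<circ> y) \<in> H" using Hs(4) by blast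
          then show ?thesis using zt by (simp add: K_def comp_assoc)
        next
          case 3
          then have "(z \<circ> y) \<circ> (?i y \<circ> w \<circ> y) \<in> H" using c Hs(4) by blast
          then have "(z \<circ> w) \<circ> y \<in> H" using t by (simp add: comp_assoc tree_aut_cancel)
          then show ?thesis using zt by (simp add: K_def)
        next
          case 4
          then have "(z \<circ> y) \<circ> ((?i y \<circ> (w \<circ> y) \<circ> y) \<circ> (?i y \<circ> ?i y)) \<in> H"
            using c Hs(4) maximal_square[OF max, of "?i y"] y by simp
          then have "z \<circ> w \<in> H" using t by (simp add: comp_assoc tree_aut_cancel)
          then show ?thesis using zt by (simp add: K_def)
        qed
      qed
    qed (use Hs(2) in \<open>auto simp: K_def\<close>)
    moreover have HK: "H \<subseteq> K" using Hs(1) by (auto simp: K_def)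
    moreover obtain n where "level_stab n \<subseteq> H" using maximal_level_stab[OF max] by blast
    moreover have "?i y \<in> K" "?i y \<notin> H"
      using y t Hs(2) Hs(3)[of "?i y"] ny tree_autD(1)[OF t(2)] by (auto simp: K_def inv_inv_eq)
    ultimately have "K = M_set" using H(3)[of K n] by blast
    then show ?thesis using x nx by (auto simp: K_def)
  qed
  then show ?thesis using cancel[of x y] cancel'[of y x] Hs(4)[of x y] y by blast
qed

lemma index_two_maximal:
  assumes K: "subgroup K M_inf" and n: "level_stab n \<subseteq> K" and ne: "K \<noteq> M_set"
    and prod: "\<And>x y. x \<in> M_set - K \<Longrightarrow> y \<in> M_set - K \<Longrightarrow> x \<circ> y \<in> K"
  shows "maximal_closed_subgroup K aut_topology M_inf"
  unfolding maximal_closed_subgroup_def carrier_M_inf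
proof (intro conjI allI impI)
  show "closed_subgroup K aut_topology M_inf" by (rule open_subgroup_closed[OF K n])
  show "K \<noteq> M_set" by (rule ne)
  fix L assume L: "closed_subgroup L aut_topology M_inf \<and> K \<subseteq> L"
  then have "subgroup L M_inf" by (simp add: closed_subgroup_def)
  note Ls = subgroup_M_infD[OF this] and Ks = subgroup_M_infD[OF K]
  show "L = K \<or> L = M_set"
  proof (cases "L = K")
    case False
    then obtain x where x: "x \<in> L" "x \<notin> K" using L by blast
    then have xt: "x \<in> M_set" "x \<in> tree_aut" using Ls(1) M_set_tree_aut by auto
    have "y \<in> L" if y: "y \<in> M_set" for y
    proof (cases "y \<in> K")
      case False
      have "inv_into UNIV x \<notin> K"
        using Ks(3)[of "inv_into UNIV x"] x(2) tree_autD(1)[OF xt(2)] by (auto simp: inv_inv_eq)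
      then have "inv_into UNIV x \<circ> y \<in> L" using prod[of "inv_into UNIV x" y] False y xt L by auto
      then have "x \<circ> (inv_into UNIV x \<circ> y) \<in> L" using Ls(4) x by blast
      then show ?thesis using xt by (simp add: tree_aut_cancel)
    qed (use L in blast)
    then show ?thesis using Ls(1) by blast
  qed simp
qed

section \<open>The four characters of M\<close>

lemma even_mult_odd:
  fixes u z :: zadic2
  assumes "2 dvd u - 1"
  shows "2 dvd u * z \<longleftrightarrow> 2 dvd z"
  using odd_mult_dvd_iff[OF assms, of 1 z] by simp

lemma even_add_iff: "2 dvd (x + y :: zadic2) \<longleftrightarrow> (2 dvd x \<longleftrightarrow> 2 dvd y)"
proof -
  have "2 dvd x + y" if "\<not> 2 dvd x" "\<not> 2 dvd y"
  proof -
    have "2 dvd (x - 1) + (y - 1) + 2" using that zadic2_parity by (intro dvd_add) auto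
    then show ?thesis by simp
  qed
  then show ?thesis by (metis dvd_add dvd_add_right_iff dvd_add_left_iff)
qed

lemma Q_even_comp:
  assumes "\<sigma> \<in> M_set" "\<tau> \<in> M_set"
  shows "2 dvd Q (\<sigma> \<circ> \<tau>) [] \<longleftrightarrow> (2 dvd Q \<sigma> [] \<longleftrightarrow> 2 dvd Q \<tau> [])"
  using assms P_odd[OF M_set_tree_aut[OF assms(1)]]
  by (simp add: Q_comp M_set_tree_aut even_add_iff even_mult_odd)

lemma R_even_comp:
  assumes "\<sigma> \<in> M_set" "\<tau> \<in> M_set"
  shows "2 dvd R (\<sigma> \<circ> \<tau>) \<longleftrightarrow> (2 dvd R \<sigma> \<longleftrightarrow> 2 dvd R \<tau>)"
  using assms P_odd[OF M_set_tree_aut[OF assms(1)]]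
  by (simp add: R_comp M_set_tree_aut even_add_iff even_mult_odd)

section \<open>The character \<open>P\<close> modulo 8 and the maximal subgroups cut out by
  characters\<close>

definition P8 :: "(node \<Rightarrow> node) \<Rightarrow> int" where
  "P8 \<sigma> = residue (P \<sigma> []) 3"

lemma P8_cases:
  assumes "\<sigma> \<in> M_set"
  shows "P8 \<sigma> \<in> {1, 3, 5, 7}"
proof -
  have "2 ^ 1 dvd P \<sigma> [] - 1" using P_odd[OF M_set_tree_aut[OF assms]] by simp
  then have "residue (P \<sigma> []) 1 = residue 1 1" by (simp only: power2_dvd_eq_residue)
  then have "residue (P \<sigma> []) (1 + 2) mod 2 ^ 1 = 1"
    unfolding residue_drop by (simp add: one_zadic2.rep_eq)
  then have "P8 \<sigma> mod 2 = 1" by (simp add: P8_def numeral_3_eq_3)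
  moreover have "0 \<le> P8 \<sigma>" "P8 \<sigma> < 8"
    using residue_range[of "P \<sigma> []" 3] by (simp_all add: P8_def)
  moreover have "k = 1 \<or> k = 3 \<or> k = 5 \<or> k = 7" if "k mod 2 = 1" "0 \<le> k" "k < 8" for k :: int
    using that by presburger
  ultimately show ?thesis by simp
qed

lemma P8_comp:
  assumes "\<sigma> \<in> M_set" "\<tau> \<in> M_set"
  shows "P8 (\<sigma> \<circ> \<tau>) = (P8 \<sigma> * P8 \<tau>) mod 8"
  using assms by (simp add: P8_def P_comp_root M_set_tree_aut times_zadic2.rep_eq)

lemma P8_eq_1_iff: "P8 \<sigma> = 1 \<longleftrightarrow> 8 dvd P \<sigma> [] - 1"
  using power2_dvd_eq_residue[of 3 "P \<sigma> []" 1] by (simp add: P8_def one_zadic2.rep_eq)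

text \<open>The parity of \<open>Q\<close> is decided on level 1, that of \<open>R\<close> on level
  2, and \<open>P\<close> modulo \<open>2 ^ Suc 2\<close> on level \<open>2 * 2 + 1\<close>.\<close>

lemma level_5_characters:
  assumes "\<sigma> \<in> level_stab 5"
  shows "2 dvd Q \<sigma> []" "2 dvd R \<sigma>" "P8 \<sigma> = 1"
proof -
  note t = level_stabD(2)[OF assms]
  have ag: "agree m \<sigma> id" if "m \<le> 5" for m
    using assms agree_mono[OF _ that] by (simp add: level_stab_def)
  show "2 dvd Q \<sigma> []" using agree_id_QR[OF t, of 0] ag[of 1] by simp
  show "2 dvd R \<sigma>" using agree_id_QR[OF t, of 1] ag[of 2] by simp
  show "P8 \<sigma> = 1" unfolding P8_eq_1_iff using agree_id_P[OF t, of 2] ag[of 5] by simp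
qed

text \<open>The predicate \<open>S\<close> encodes a character into the group of order two, true on
  its kernel; triviality on \<open>level_stab 5\<close> is its continuity and \<open>x0\<close>
  shows that it is nontrivial.\<close>

lemma character_maximal:
  assumes mult: "\<And>x y. x \<in> M_set \<Longrightarrow> y \<in> M_set \<Longrightarrow> S (x \<circ> y) \<longleftrightarrow> (S x \<longleftrightarrow> S y)"
    and 5: "\<And>x. x \<in> level_stab 5 \<Longrightarrow> S x" and ex: "x0 \<in> M_set" "\<not> S x0"
  shows "subgroup {x \<in> M_set. S x} M_inf"
    "maximal_closed_subgroup {x \<in> M_set. S x} aut_topology M_inf"
proof -
  have S_id: "S id" using mult[of id id] by simp
  show sub: "subgroup {x \<in> M_set. S x} M_inf"
  proof (rule subgroup_M_infI)
    show "inv_into UNIV x \<in> {x \<in> M_set. S x}" if "x \<in> {x \<in> M_set. S x}" for x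
      using mult[of x "inv_into UNIV x"] that S_id by (simp add: M_set_tree_aut)
  qed (use S_id mult in auto)
  have "level_stab 5 \<subseteq> {x \<in> M_set. S x}" using 5 level_stabD(1) by auto
  then show "maximal_closed_subgroup {x \<in> M_set. S x} aut_topology M_inf"
    using ex mult by (intro index_two_maximal[OF sub]) auto
qed

definition N_set :: "(node \<Rightarrow> node) set" where
  "N_set = {\<sigma> \<in> M_set. 2 dvd Q \<sigma> [] \<and> 2 dvd R \<sigma> \<and> P8 \<sigma> = 1}"

lemma P8_dil: "P8 (dil k) = (1 + 2 * int k) mod 8"
  by (simp add: P8_def plus_zadic2.rep_eq times_zadic2.rep_eq one_zadic2.rep_eq mod_simps
      residue_of_nat residue_of_int[of 2 3, simplified])

text \<open>For odd \<open>P\<close>, residues 1 and 5 mean 1 modulo 4, and residues 1 and 7 mean a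
  sign modulo 8; these two characters of the units modulo 8 have only 1 in their common
  kernel.\<close>

lemma
  shows Q_maximal: "maximal_closed_subgroup {x \<in> M_set. 2 dvd Q x []} aut_topology M_inf"
    and R_maximal: "maximal_closed_subgroup {x \<in> M_set. 2 dvd R x} aut_topology M_inf"
    and P4_maximal: "maximal_closed_subgroup {x \<in> M_set. P8 x \<in> {1, 5}} aut_topology M_inf"
    and P8_maximal: "maximal_closed_subgroup {x \<in> M_set. P8 x \<in> {1, 7}} aut_topology M_inf"
proof -
  show "maximal_closed_subgroup {x \<in> M_set. 2 dvd Q x []} aut_topology M_inf"
    by (rule character_maximal(2)[where ?x0.0 = gen_a])
      (use level_5_characters Q_even_comp not_two_dvd_one in auto)
  show "maximal_closed_subgroup {x \<in> M_set. 2 dvd R x} aut_topology M_inf"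
    by (rule character_maximal(2)[where ?x0.0 = gen_b])
      (use level_5_characters R_even_comp not_two_dvd_one in auto)
  have "P8 (x \<circ> y) \<in> {1, 5} \<longleftrightarrow> (P8 x \<in> {1, 5} \<longleftrightarrow> P8 y \<in> {1, 5})"
    "P8 (x \<circ> y) \<in> {1, 7} \<longleftrightarrow> (P8 x \<in> {1, 7} \<longleftrightarrow> P8 y \<in> {1, 7})"
    if "x \<in> M_set" "y \<in> M_set" for x y
    using P8_cases[OF that(1)] P8_cases[OF that(2)] P8_comp[OF that] by auto
  \<comment> \<open>The witness \<open>dil 1\<close> has \<open>P\<close> equal to 3, outside both
    sets.\<close>
  then show "maximal_closed_subgroup {x \<in> M_set. P8 x \<in> {1, 5}} aut_topology M_inf"
    "maximal_closed_subgroup {x \<in> M_set. P8 x \<in> {1, 7}} aut_topology M_inf"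
    by (intro character_maximal(2)[where ?x0.0 = "dil 1"];
        use level_5_characters P8_dil[of 1] in auto)+
qed

lemma frattini_subset_N_set: "frattini aut_topology M_inf \<subseteq> N_set"
proof
  fix x assume x: "x \<in> frattini aut_topology M_inf"
  then have "x \<in> H" if "maximal_closed_subgroup H aut_topology M_inf" for H
    using that by (auto simp: frattini_def)
  from this[OF Q_maximal] this[OF R_maximal] this[OF P4_maximal] this[OF P8_maximal]
  show "x \<in> N_set" by (auto simp: N_set_def)
qed

section \<open>The common kernel lies in every maximal closed subgroup\<close>

text \<open>Hensel lifting of a square root, one bit at a time from modulo 8 on.\<close>

lemma zadic2_approx_square:
  fixes x :: zadic2
  assumes "8 dvd x - 1"
  shows "\<exists>k. 2 ^ n dvd x - (1 + 2 * of_nat k) ^ 2"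
proof -
  have "\<exists>k. 2 ^ (m + 3) dvd x - (1 + 2 * of_nat k) ^ 2" for m
  proof (induction m)
    case 0
    show ?case using assms by (intro exI[of _ 0]) simp
  next
    case (Suc m)
    then obtain k y where k: "x - (1 + 2 * of_nat k) ^ 2 = 2 ^ (m + 3) * y" by (auto elim: dvdE)
    from zadic2_parity[of y] show ?case
    proof
      assume "2 dvd y"
      then have "2 ^ (m + 3) * 2 dvd x - (1 + 2 * of_nat k) ^ 2"
        unfolding k by (rule mult_dvd_mono[OF dvd_refl])
      then show ?case by (intro exI[of _ k]) (simp only: power_Suc2 add_Suc)
    next
      assume "2 dvd y - 1"
      then obtain z where z: "y = 1 + 2 * z" by (auto elim!: dvdE simp: algebra_simps)
      \<comment> \<open>Raising \<open>k\<close> by \<open>2 ^ (m + 1)\<close> changes the square by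
        an odd multiple of \<open>2 ^ (m + 3)\<close>, which makes the odd cofactor \<open>y\<close>
        even.\<close>
      have "x - (1 + 2 * of_nat (k + 2 ^ (m + 1))) ^ 2 =
          (x - (1 + 2 * of_nat k) ^ 2) - 2 ^ (m + 3) * (1 + 2 * of_nat k) - 2 ^ (m + 4) * 2 ^ m"
        by (simp add: power2_eq_square algebra_simps power_add)
      also have "\<dots> = 2 ^ (Suc m + 3) * (z - of_nat k - 2 ^ m)"
        unfolding k z by (simp add: algebra_simps power_add)
      finally show ?case by (intro exI[of _ "k + 2 ^ (m + 1)"]) simp
    qed
  qed
  from this[of n] obtain k where "2 ^ (n + 3) dvd x - (1 + 2 * of_nat k) ^ 2" by blast
  then have "2 ^ n dvd x - (1 + 2 * of_nat k) ^ 2" by (rule dvd_trans[OF le_imp_power_dvd, rotated]) simp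
  then show ?thesis by blast
qed

text \<open>By index two, membership in \<open>H\<close> is a character, determined on
  \<open>G_ab\<close> by its values at the two generators. The right side is the product of the
  parity characters of \<open>Q\<close> and \<open>R\<close>, with a factor dropped when the
  matching generator lies in \<open>H\<close>.\<close>

lemma G_ab_in_maximal:
  assumes max: "maximal_closed_subgroup H aut_topology M_inf" and w: "w \<in> G_ab"
  shows "w \<in> H \<longleftrightarrow> ((gen_a \<in> H \<or> 2 dvd Q w []) \<longleftrightarrow> (gen_b \<in> H \<or> 2 dvd R w))"
  using w
proof (induction rule: G_ab_induct)
  note ind = maximal_index_two[OF max]
  have idH: "id \<in> H" using ind[of id id] by simp
  {
    case id
    show ?case using idH by (simp del: id_apply)
  next
    case gen_a
    show ?case using not_two_dvd_one by simp
  next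
    case gen_b
    show ?case using not_two_dvd_one by simp
  next
    case (inv x)
    have x: "x \<in> M_set" using inv G_ab_sub(1) by auto
    have "inv_into UNIV x \<in> H \<longleftrightarrow> x \<in> H"
      using ind[of x "inv_into UNIV x"] x idH by (simp add: M_set_tree_aut)
    then show ?case using inv x by (simp add: P_inv P_G_ab)
  next
    case (comp x y)
    then have M: "x \<in> M_set" "y \<in> M_set" using G_ab_sub(1) by auto
    show ?case
      unfolding ind[OF M] Q_even_comp[OF M] R_even_comp[OF M] using comp by blast
  }
qed

lemma N_set_subset_maximal:
  assumes max: "maximal_closed_subgroup H aut_topology M_inf"
  shows "N_set \<subseteq> H"
proof
  fix \<sigma> assume "\<sigma> \<in> N_set"
  then have \<sigma>: "\<sigma> \<in> M_set" "2 dvd Q \<sigma> []" "2 dvd R \<sigma>" "8 dvd P \<sigma> [] - 1"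
    by (auto simp: N_set_def P8_eq_1_iff)
  note Hs = subgroup_M_infD[OF maximal_closedD(1)[OF max]]
  obtain n where n: "level_stab n \<subseteq> H" using maximal_level_stab[OF max] by blast
  \<comment> \<open>Level \<open>n\<close> decides membership in \<open>H\<close>, level 2 the
    parities of \<open>Q\<close> and \<open>R\<close>.\<close>
  define m where "m = max n 2"
  obtain k where k: "2 ^ Suc m dvd P \<sigma> [] - (1 + 2 * of_nat k) ^ 2"
    using zadic2_approx_square[OF \<sigma>(4)] by blast
  \<comment> \<open>A square, hence in \<open>H\<close>, with \<open>Q\<close> and \<open>R\<close>
    even; it absorbs \<open>P \<sigma> []\<close> up to the precision \<open>Suc m\<close> that
    \<open>G_ab_approx\<close> demands.\<close>
  define \<theta> where "\<theta> = dil k \<circ> dil k"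
  define \<tau> where "\<tau> = \<sigma> \<circ> inv_into UNIV \<theta>"
  have M: "\<theta> \<in> M_set" "\<tau> \<in> M_set" using \<sigma> by (simp_all add: \<theta>_def \<tau>_def)
  note t = M[THEN M_set_tree_aut]
  have \<theta>H: "\<theta> \<in> H" unfolding \<theta>_def by (rule maximal_square[OF max]) simp
  have \<sigma>eq: "\<sigma> = \<tau> \<circ> \<theta>" unfolding \<tau>_def using t by (simp add: comp_assoc)
  have P\<theta>: "P \<theta> [] = (1 + 2 * of_nat k) ^ 2"
    unfolding \<theta>_def by (simp add: P_comp_root power2_eq_square)
  then have "P \<sigma> [] - (1 + 2 * of_nat k) ^ 2 = P \<theta> [] * (P \<tau> [] - 1)"
    unfolding \<sigma>eq using P_comp_root[OF M(2) t(1)] by (simp add: algebra_simps)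
  then have "2 ^ Suc m dvd P \<tau> [] - 1"
    using k odd_mult_dvd_iff[OF P_odd[OF t(1)]] by (simp only:)
  then obtain w where w: "w \<in> G_ab" "agree m w \<tau>" using G_ab_approx[OF M(2)] by blast
  have wM: "w \<in> M_set" "w \<in> tree_aut" using w(1) G_ab_sub(1) M_set_tree_aut by auto
  define z where "z = inv_into UNIV w \<circ> \<tau>"
  have z: "z \<in> M_set" "z \<in> tree_aut" unfolding z_def using wM M t by simp_all
  have \<tau>eq: "\<tau> = w \<circ> z" unfolding z_def using wM by (simp add: tree_aut_cancel)
  have zid: "agree m z id"
    using agree_comp[OF agree_refl agree_sym[OF w(2)] t(2), of "inv_into UNIV w"] wM by (simp add: z_def)
  then have "agree 1 z id" "agree 2 z id" by (auto elim!: agree_mono simp: m_def)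
  then have zQ: "2 dvd Q z []" "2 dvd R z"
    using agree_id_QR[OF z(2), of 0] agree_id_QR[OF z(2), of 1] by auto
  have "agree n z id" using zid by (rule agree_mono) (simp add: m_def)
  then have zH: "z \<in> H" using n z by (auto simp: level_stab_def)
  have "2 dvd Q \<theta> []" "2 dvd R \<theta>" by (simp_all add: \<theta>_def Q_even_comp R_even_comp)
  then have "2 dvd Q w []" "2 dvd R w"
    using \<sigma>(2,3) zQ unfolding \<sigma>eq \<tau>eq
    by (simp_all add: Q_even_comp R_even_comp M z wM)
  then have "w \<in> H" using G_ab_in_maximal[OF max w(1)] by simp
  then show "\<sigma> \<in> H" unfolding \<sigma>eq \<tau>eq using Hs(4) zH \<theta>H by blast
qed

lemma frattini_eq_N_set: "frattini aut_topology M_inf = N_set"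
  using frattini_subset_N_set N_set_subset_maximal
  by (auto simp: frattini_def carrier_M_inf N_set_def)

section \<open>The index\<close>

lemma N_set_subgroup: "subgroup N_set M_inf"
proof -
  have eq: "N_set = ({x \<in> M_set. 2 dvd Q x []} \<inter> {x \<in> M_set. 2 dvd R x}) \<inter>
      ({x \<in> M_set. P8 x \<in> {1, 5}} \<inter> {x \<in> M_set. P8 x \<in> {1, 7}})"
    by (auto simp: N_set_def)
  show ?thesis
    unfolding eq
    by (intro M.subgroups_Inter_pair maximal_closedD(1)[OF Q_maximal] maximal_closedD(1)[OF R_maximal]
        maximal_closedD(1)[OF P4_maximal] maximal_closedD(1)[OF P8_maximal])
qed

definition character :: "(node \<Rightarrow> node) \<Rightarrow> bool \<times> bool \<times> int" where
  "character \<sigma> = (2 dvd Q \<sigma> [], 2 dvd R \<sigma>, P8 \<sigma>)"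

lemma character_eq_iff:
  assumes "x \<in> M_set" "y \<in> M_set"
  shows "character x = character y \<longleftrightarrow> N_set #>\<^bsub>M_inf\<^esub> x = N_set #>\<^bsub>M_inf\<^esub> y"
proof -
  have t: "y \<in> tree_aut" using assms M_set_tree_aut by blast
  define z where "z = x \<circ> inv_into UNIV y"
  have z: "z \<in> M_set" "x = z \<circ> y" using assms t by (simp_all add: z_def comp_assoc)
  have "character x = character y \<longleftrightarrow> z \<in> N_set"
    unfolding character_def N_set_def z(2)
    using P8_cases[OF z(1)] P8_cases[OF assms(2)]
    by (auto simp: Q_even_comp R_even_comp P8_comp z(1) assms(2))
  also have "\<dots> \<longleftrightarrow> x \<in> N_set #>\<^bsub>M_inf\<^esub> y"
  proof
    assume "z \<in> N_set"
    then show "x \<in> N_set #>\<^bsub>M_inf\<^esub> y" using z(2) by (auto simp: r_coset_def)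
  next
    assume "x \<in> N_set #>\<^bsub>M_inf\<^esub> y"
    then obtain h where "h \<in> N_set" "x = h \<circ> y" by (auto simp: r_coset_def)
    moreover from this have "z = h" using t by (simp add: z_def comp_assoc)
    ultimately show "z \<in> N_set" by simp
  qed
  also have "\<dots> \<longleftrightarrow> N_set #>\<^bsub>M_inf\<^esub> x = N_set #>\<^bsub>M_inf\<^esub> y"
    using M.repr_independence[OF _ _ N_set_subgroup, of x y] M.rcos_self[OF _ N_set_subgroup, of x] assms
    by auto
  finally show ?thesis .
qed

lemma character_image: "character ` M_set = UNIV \<times> UNIV \<times> {1, 3, 5, 7}"
proof
  show "character ` M_set \<subseteq> UNIV \<times> UNIV \<times> {1, 3, 5, 7}"
    using P8_cases by (auto simp: character_def)
  show "UNIV \<times> UNIV \<times> {1, 3, 5, 7} \<subseteq> character ` M_set"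
  proof
    fix v :: "bool \<times> bool \<times> int" assume "v \<in> UNIV \<times> UNIV \<times> {1, 3, 5, 7}"
    then obtain i j c where v: "v = (i, j, c)" "c \<in> {1, 3, 5, 7}" by auto
    \<comment> \<open>The generators switch the parities of \<open>Q\<close> and \<open>R\<close>
      independently and leave \<open>P\<close> alone; the \<open>dil\<close> factor sets
      \<open>P\<close> to \<open>1 + 2 * ((c - 1) div 2) = c\<close>.\<close>
    define x where "x = (if i then id else gen_a) \<circ> ((if j then id else gen_b) \<circ> dil (nat ((c - 1) div 2)))"
    have P1: "P8 id = 1" "P8 gen_a = 1" "P8 gen_b = 1"
      by (simp_all add: P8_eq_1_iff)
    have "character x = v"
      unfolding x_def character_def v using v(2)
      by (auto simp: Q_even_comp R_even_comp P8_comp P1 P8_dil QR_dil_even not_two_dvd_one)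
    moreover have "x \<in> M_set" by (simp add: x_def)
    ultimately show "v \<in> character ` M_set" by blast
  qed
qed

lemma card_image_eq_card_image:
  assumes "\<And>x y. x \<in> A \<Longrightarrow> y \<in> A \<Longrightarrow> f x = f y \<longleftrightarrow> g x = g y"
  shows "card (f ` A) = card (g ` A)"
proof (rule bij_betw_same_card)
  show "bij_betw (\<lambda>v. g (inv_into A f v)) (f ` A) (g ` A)"
    unfolding bij_betw_def
  proof
    have *: "inv_into A f (f x) \<in> A" "f (inv_into A f (f x)) = f x" if "x \<in> A" for x
      using that by (simp_all add: inv_into_into f_inv_into_f)
    show "inj_on (\<lambda>v. g (inv_into A f v)) (f ` A)"
    proof (rule inj_onI)
      fix v v' assume "v \<in> f ` A" "v' \<in> f ` A" and eq: "g (inv_into A f v) = g (inv_into A f v')"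
      then obtain x x' where x: "x \<in> A" "v = f x" "x' \<in> A" "v' = f x'" by blast
      show "v = v'" using eq * x assms by metis
    qed
    have "g (inv_into A f (f x)) = g x" if "x \<in> A" for x
      using * that assms by metis
    then show "(\<lambda>v. g (inv_into A f v)) ` f ` A = g ` A" by (simp add: image_image)
  qed
qed

lemma card_rcosets_N_set: "card (rcosets\<^bsub>M_inf\<^esub> N_set) = 16"
proof -
  have "rcosets\<^bsub>M_inf\<^esub> N_set = (\<lambda>x. N_set #>\<^bsub>M_inf\<^esub> x) ` M_set"
    by (auto simp: RCOSETS_def carrier_M_inf)
  then have "card (rcosets\<^bsub>M_inf\<^esub> N_set) = card (character ` M_set)"
    using card_image_eq_card_image[of M_set "\<lambda>x. N_set #>\<^bsub>M_inf\<^esub> x" character] character_eq_iff by simp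
  then show ?thesis by (simp add: character_image card_cartesian_product)
qed

section \<open>The action on the second level\<close>

lemma even_of_nat_zadic2: "2 dvd (of_nat k :: zadic2) \<longleftrightarrow> even k"
  using two_dvd_of_int[of "int k"] by simp

lemma Q_even_iff:
  assumes "\<sigma> \<in> tree_aut"
  shows "2 dvd Q \<sigma> [] \<longleftrightarrow> Par \<sigma> [] = 0"
  by (rule Par_root_cases[OF assms]) (simp_all add: Q_root[OF assms] even_add_iff not_two_dvd_one)

text \<open>With level 1 fixed, the action on level 2 is a product of sibling transpositions, one
  for each active node among \<open>[a]\<close> and \<open>[b]\<close>.\<close>

lemma evenperm_level_2:
  assumes \<sigma>: "\<sigma> \<in> tree_aut" and ab: "\<sigma> [a] = [a]" "\<sigma> [b] = [b]"
  shows "evenperm (restrict_id \<sigma> {[a, a], [a, b], [b, a], [b, b]}) \<longleftrightarrow> even (Par \<sigma> [a] + Par \<sigma> [b])"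
proof -
  define f where "f c = (if Par \<sigma> [c] = 0 then id else Transposition.transpose [c, a] [c, b])" for c
  have vals: "\<sigma> [c, a] = f c [c, a] \<and> \<sigma> [c, b] = f c [c, b]" if "\<sigma> [c] = [c]" for c
    by (rule Par_cases[OF \<sigma>, of "[c]"]) (use that in \<open>simp_all add: f_def\<close>)
  have other: "f c (d # v) = d # v" if "d \<noteq> c" for c d v
    using that by (auto simp: f_def Transposition.transpose_def)
  have ends: "f c [c, d] \<in> {[c, a], [c, b]}" for c d
    by (cases d) (auto simp: f_def)
  have "restrict_id \<sigma> {[a, a], [a, b], [b, a], [b, b]} = f a \<circ> f b"
  proof
    fix w
    consider "w = [a, a]" | "w = [a, b]" | "w = [b, a]" | "w = [b, b]"
      | "w \<notin> {[a, a], [a, b], [b, a], [b, b]}" by blast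
    then show "restrict_id \<sigma> {[a, a], [a, b], [b, a], [b, b]} w = (f a \<circ> f b) w"
      by cases (use vals[OF ab(1)] vals[OF ab(2)] other[of a b] other[of b a] ends[of b] in
          \<open>auto simp: restrict_id_def f_def Transposition.transpose_def\<close>)
  qed
  moreover have "permutation (f c)" for c by (simp add: f_def permutation_swap_id)
  moreover have "evenperm (f c) \<longleftrightarrow> even (Par \<sigma> [c])" for c
    by (simp add: f_def evenperm_swap Par_def)
  ultimately show ?thesis by (simp add: evenperm_comp)
qed

text \<open>Modulo 2 each \<open>Q\<close> reduces to its leading term, the parity; with
  \<open>evenperm_level_2\<close> this turns the parity of \<open>R\<close> into a sign on level
  2.\<close>

lemma R_even_iff:
  assumes "\<sigma> \<in> tree_aut"
  shows "2 dvd R \<sigma> \<longleftrightarrow> even (Par \<sigma> [a] + Par \<sigma> [b])"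
proof -
  have "Q \<sigma> [c] = of_nat (Par \<sigma> [c]) + 2 * R (sec \<sigma> [c, a])" for c
    using Q_root[of "sec \<sigma> [c]"] assms by (simp add: Q_sec Par_sec sec_sec)
  then show ?thesis by (simp add: R_def even_add_iff even_of_nat_zadic2)
qed

theorem theorem5p3:
  shows "card (rcosets\<^bsub>M_inf\<^esub> (frattini aut_topology M_inf)) = 16 \<and>
    frattini aut_topology M_inf =
      {\<sigma> \<in> carrier M_inf.
         \<sigma> [a] = [a] \<and> \<sigma> [b] = [b] \<and>
         evenperm (restrict_id \<sigma> {[a, a], [a, b], [b, a], [b, b]}) \<and>
         8 dvd (P \<sigma> [] - 1)}"
proof
  show "card (rcosets\<^bsub>M_inf\<^esub> (frattini aut_topology M_inf)) = 16"
    by (simp add: frattini_eq_N_set card_rcosets_N_set)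
  have "2 dvd Q \<sigma> [] \<and> 2 dvd R \<sigma> \<longleftrightarrow> \<sigma> [a] = [a] \<and> \<sigma> [b] = [b] \<and>
      evenperm (restrict_id \<sigma> {[a, a], [a, b], [b, a], [b, b]})" if "\<sigma> \<in> M_set" for \<sigma>
  proof -
    note t = M_set_tree_aut[OF that]
    have "2 dvd Q \<sigma> [] \<longleftrightarrow> \<sigma> [a] = [a] \<and> \<sigma> [b] = [b]"
      unfolding Q_even_iff[OF t] by (simp add: Par_def tree_autD(2)[OF t])
    then show ?thesis using evenperm_level_2[OF t] R_even_iff[OF t] by blast
  qed
  then show "frattini aut_topology M_inf =
      {\<sigma> \<in> carrier M_inf.
         \<sigma> [a] = [a] \<and> \<sigma> [b] = [b] \<and>
         evenperm (restrict_id \<sigma> {[a, a], [a, b], [b, a], [b, b]}) \<and>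
         8 dvd (P \<sigma> [] - 1)}"
    unfolding frattini_eq_N_set N_set_def P8_eq_1_iff carrier_M_inf by blast
qed

end
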